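(* Let $V$ be a finite-dimensional complex representation of a finite group $G$, with $G \subset \mathrm{GL}(V)$, let $H\subset G$ be a subgroup, $B=S(V)$, and $\mathcal D_2=\mathcal D_B^G\subset\mathcal D_1=\mathcal D_B^H$. Let $W$ be an irreducible representation of $H$ and $N\subset B$ a simple $\mathcal D_1$-submodule such that $N\sim_H W$. Assume that the restriction of $N^{ann}=\mathrm{Ann}_{\mathcal D_1^-}(N)$ to a $\mathcal D_2^0$-module is simple, and put $r=\dim_{\mathbb C}N^{ann}$. Then: (1) $j_H^G(W)\cong (W_1)^r$ (direct sum of $r$ copies), where $W_1$ is an irreducible $G$-representation. (2) $W_1\sim_G J_H^G(N)$; so if $r=1$, then $j_H^G(W)\sim_G J_H^G(N)$.
   Context: $B=S(V)=\mathbb C[x_1,\dots,x_n]$ with $x_i$ a basis of $V$ in degree $1$; $\mathcal D_B$ is the Weyl algebra, graded by $\deg x_i=1$, $\deg\partial_i=-1$, with the induced action of $G$, $(g\cdot P)(b)=g(P(g^{-1}b))$. For a graded subring $\mathcal D\subset \mathcal D_B$, $\mathcal D^0$ is the degree $0$ part and $\mathcal D^-$ the sum of parts of negative degree; $\mathrm{Ann}_{\mathcal D^-}(N)=\{n\in N:\mathcal D^-n=0\}$. For a finite group $K\subset \mathrm{GL}(V)$, $B$ is a semisimple $\mathcal D_B^K$-module and a semisimple $K$-representation, and its isotypic components for the two structures coincide. For an irreducible $K$-representation $U$ and a simple $\mathcal D_B^K$-submodule $N$ of $B$, one writes $N\sim_K U$ (or $U\sim_K N$) if the $U$-isotypic component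 of $B$ (as $K$-representation) equals the $N$-isotypic component of $B$ (as $\mathcal D_B^K$-module). Differential MLS-restriction: $J_H^G(N)=\mathcal D_2\cdot\mathrm{Ann}_{\mathcal D_1^-}(N)$ for a $\mathcal D_1$-submodule $N\subset B$. MLS-induction: for an irreducible $H$-representation $W$ with $W$-isotypic component $B_W\subset B$, let $d_W$ be the least integer such that the homogeneous component $B_W^{d_W}$ of degree $d_W$ is nonzero; then $j_H^G(W)=\mathbb C[G]B_W^{d_W}\subset B$ (no condition that $B_W^{d_W}\cong W$ is imposed). *)

theory Defs
  imports
    "HOL-Library.Poly_Mapping"
    "HOL-Library.Function_Algebras"
    "Jordan_Normal_Form.Matrix"
begin

section \<open>The polynomial algebra\<close>

text \<open>
  Polynomials in the variables \<open>x\<^sub>0, x\<^sub>1, \<dots>\<close>; the algebra \<open>B = S(V)\<close> for \<open>V = \<complex>\<^sup>n\<close> is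
  the set \<open>polys n\<close> of polynomials in \<open>x\<^sub>0, \<dots>, x\<^bsub>n-1\<^esub>\<close>. The dimension \<open>n\<close> is a
  natural number rather than a type so that \<open>n = 0\<close> is allowed.
\<close>

type_synonym cpoly = "(nat \<Rightarrow>\<^sub>0 nat) \<Rightarrow>\<^sub>0 complex"

definition smul :: "complex \<Rightarrow> cpoly \<Rightarrow> cpoly" where
  "smul c p = Poly_Mapping.single 0 c * p"

interpretation cpoly: vector_space smul
  by unfold_locales
    (simp_all add: smul_def algebra_simps single_add mult_single flip: mult.assoc)

definition X :: "nat \<Rightarrow> cpoly" where
  "X i = Poly_Mapping.single (Poly_Mapping.single i 1) 1"

definition polys :: "nat \<Rightarrow> cpoly set" where
  "polys n = {p. \<forall>m\<in>Poly_Mapping.keys p. Poly_Mapping.keys m \<subseteq> {..<n}}"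

definition mdeg :: "(nat \<Rightarrow>\<^sub>0 nat) \<Rightarrow> nat" where
  "mdeg m = (\<Sum>i\<in>Poly_Mapping.keys m. Poly_Mapping.lookup m i)"

definition hom_polys :: "nat \<Rightarrow> nat \<Rightarrow> cpoly set" where
  "hom_polys n d = {p \<in> polys n. \<forall>m\<in>Poly_Mapping.keys p. mdeg m = d}"

definition pd :: "nat \<Rightarrow> cpoly \<Rightarrow> cpoly" where
  "pd i p = (\<Sum>m\<in>Poly_Mapping.keys p.
     Poly_Mapping.single (m - Poly_Mapping.single i 1)
       (of_nat (Poly_Mapping.lookup m i) * Poly_Mapping.lookup p m))"


section \<open>Linear groups acting on polynomials\<close>

definition GL :: "nat \<Rightarrow> complex mat monoid" where
  "GL n = units_of (ring_mat TYPE(complex) n ())"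

definition mat_group :: "nat \<Rightarrow> complex mat set \<Rightarrow> complex mat monoid" where
  "mat_group n K = (GL n)\<lparr>carrier := K\<rparr>"

text \<open>
  The algebra endomorphism that extends the linear map \<open>g\<close> of \<open>V\<close> to \<open>S(V)\<close>: the image of
  \<open>x\<^sub>j\<close> is given by the \<open>j\<close>-th column of \<open>g\<close>, which makes this a left action.
\<close>

definition act :: "complex mat \<Rightarrow> cpoly \<Rightarrow> cpoly" where
  "act g p = (\<Sum>m\<in>Poly_Mapping.keys p. smul (Poly_Mapping.lookup p m)
     (\<Prod>j\<in>Poly_Mapping.keys m.
        (\<Sum>i<dim_row g. smul (g $$ (i, j)) (X i)) ^ Poly_Mapping.lookup m j))"


section \<open>Representations\<close>

record ('g, 'w) rep =
  Space :: "'w set"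
  scal :: "complex \<Rightarrow> 'w \<Rightarrow> 'w"
  gact :: "'g \<Rightarrow> 'w \<Rightarrow> 'w"

definition representation ::
  "('g, 'm) monoid_scheme \<Rightarrow> ('g, 'w::ab_group_add) rep \<Rightarrow> bool" where
  "representation K R \<longleftrightarrow>
     vector_space (scal R) \<and> module.subspace (scal R) (Space R) \<and>
     (\<forall>g\<in>carrier K.
        (\<forall>u\<in>Space R. gact R g u \<in> Space R) \<and>
        (\<forall>u\<in>Space R. \<forall>v\<in>Space R. gact R g (u + v) = gact R g u + gact R g v) \<and>
        (\<forall>c. \<forall>u\<in>Space R. gact R g (scal R c u) = scal R c (gact R g u))) \<and>
     (\<forall>u\<in>Space R. gact R \<one>\<^bsub>K\<^esub> u = u) \<and>
     (\<forall>g\<in>carrier K. \<forall>h\<in>carrier K. \<forall>u\<in>Space R.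
        gact R (g \<otimes>\<^bsub>K\<^esub> h) u = gact R g (gact R h u))"

definition invariant_subspace ::
  "('g, 'm) monoid_scheme \<Rightarrow> ('g, 'w::ab_group_add) rep \<Rightarrow> 'w set \<Rightarrow> bool" where
  "invariant_subspace K R U \<longleftrightarrow>
     module.subspace (scal R) U \<and> U \<subseteq> Space R \<and> (\<forall>g\<in>carrier K. \<forall>u\<in>U. gact R g u \<in> U)"

definition irreducible_rep ::
  "('g, 'm) monoid_scheme \<Rightarrow> ('g, 'w::ab_group_add) rep \<Rightarrow> bool" where
  "irreducible_rep K R \<longleftrightarrow>
     representation K R \<and> Space R \<noteq> {0} \<and>
     (\<forall>U. invariant_subspace K R U \<longrightarrow> U = {0} \<or> U = Space R)"

definition rep_iso ::
  "('g, 'm) monoid_scheme \<Rightarrow> ('g, 'v::ab_group_add) rep \<Rightarrow> ('g, 'w::ab_group_add) rep \<Rightarrow> bool" where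
  "rep_iso K R S \<longleftrightarrow>
     (\<exists>f. bij_betw f (Space R) (Space S) \<and>
        (\<forall>u\<in>Space R. \<forall>v\<in>Space R. f (u + v) = f u + f v) \<and>
        (\<forall>c. \<forall>u\<in>Space R. f (scal R c u) = scal S c (f u)) \<and>
        (\<forall>g\<in>carrier K. \<forall>u\<in>Space R. f (gact R g u) = gact S g (f u)))"

text \<open>The direct sum of \<open>r\<close> copies; the vectors are \<open>r\<close>-tuples, padded by \<open>0\<close>.\<close>

definition rep_power :: "nat \<Rightarrow> ('g, 'w::ab_group_add) rep \<Rightarrow> ('g, nat \<Rightarrow> 'w) rep" where
  "rep_power r R =
     \<lparr>Space = {f. (\<forall>i<r. f i \<in> Space R) \<and> (\<forall>i\<ge>r. f i = 0)},
      scal = (\<lambda>c f i. scal R c (f i)),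
      gact = (\<lambda>g f i. if i < r then gact R g (f i) else 0)\<rparr>"

text \<open>A subspace \<open>U\<close> of \<open>\<complex>[x\<^sub>0, x\<^sub>1, \<dots>]\<close>, viewed as a representation by restriction.\<close>

definition poly_rep :: "cpoly set \<Rightarrow> (complex mat, cpoly) rep" where
  "poly_rep U = \<lparr>Space = U, scal = smul, gact = act\<rparr>"

definition rep_component ::
  "nat \<Rightarrow> complex mat set \<Rightarrow> (complex mat, 'w::ab_group_add) rep \<Rightarrow> cpoly set" where
  "rep_component n K W = cpoly.span (\<Union>{U.
     invariant_subspace (mat_group n K) (poly_rep (polys n)) U \<and>
     irreducible_rep (mat_group n K) (poly_rep U) \<and>
     rep_iso (mat_group n K) (poly_rep U) W})"


section \<open>Differential operators\<close>

text \<open>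
  The Weyl algebra is the subalgebra of the linear endomorphisms generated by \<open>x\<^sub>i\<close> and
  \<open>\<partial>\<^sub>i\<close> for \<open>i < n\<close>. Its elements are functions on all of \<open>\<complex>[x\<^sub>0, x\<^sub>1, \<dots>]\<close>. Nothing is
  lost by that: an element of the Weyl algebra is determined by its restriction to \<open>polys n\<close>,
  and only this restriction is used below.
\<close>

inductive_set weyl :: "nat \<Rightarrow> (cpoly \<Rightarrow> cpoly) set" for n where
  scalar: "smul c \<in> weyl n"
| var: "i < n \<Longrightarrow> (\<lambda>b. X i * b) \<in> weyl n"
| partial: "i < n \<Longrightarrow> pd i \<in> weyl n"
| add: "P \<in> weyl n \<Longrightarrow> Q \<in> weyl n \<Longrightarrow> (\<lambda>b. P b + Q b) \<in> weyl n"
| comp: "P \<in> weyl n \<Longrightarrow> Q \<in> weyl n \<Longrightarrow> (\<lambda>b. P (Q b)) \<in> weyl n"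

text \<open>The grading with \<open>deg x\<^sub>i = 1\<close> and \<open>deg \<partial>\<^sub>i = -1\<close>.\<close>

inductive weyl_homog :: "nat \<Rightarrow> int \<Rightarrow> (cpoly \<Rightarrow> cpoly) \<Rightarrow> bool" for n where
  zero: "weyl_homog n k (\<lambda>b. 0)"
| scalar: "weyl_homog n 0 (smul c)"
| var: "i < n \<Longrightarrow> weyl_homog n 1 (\<lambda>b. X i * b)"
| partial: "i < n \<Longrightarrow> weyl_homog n (-1) (pd i)"
| add: "weyl_homog n k P \<Longrightarrow> weyl_homog n k Q \<Longrightarrow> weyl_homog n k (\<lambda>b. P b + Q b)"
| comp: "weyl_homog n k P \<Longrightarrow> weyl_homog n l Q \<Longrightarrow> weyl_homog n (k + l) (\<lambda>b. P (Q b))"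

definition weyl_inv :: "nat \<Rightarrow> complex mat set \<Rightarrow> (cpoly \<Rightarrow> cpoly) set" where
  "weyl_inv n K =
     {P \<in> weyl n. \<forall>g\<in>K. \<forall>b\<in>polys n. act g (P (act (inv\<^bsub>GL n\<^esub> g) b)) = P b}"

definition deg0_part :: "nat \<Rightarrow> (cpoly \<Rightarrow> cpoly) set \<Rightarrow> (cpoly \<Rightarrow> cpoly) set" where
  "deg0_part n D = {P \<in> D. weyl_homog n 0 P}"

definition neg_part :: "nat \<Rightarrow> (cpoly \<Rightarrow> cpoly) set \<Rightarrow> (cpoly \<Rightarrow> cpoly) set" where
  "neg_part n D = {(\<lambda>b. \<Sum>k\<in>I. P k b) | (I :: int set) P.
     finite I \<and> (\<forall>k\<in>I. k < 0 \<and> P k \<in> D \<and> weyl_homog n k (P k))}"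

definition annihilated :: "(cpoly \<Rightarrow> cpoly) set \<Rightarrow> cpoly set \<Rightarrow> cpoly set" where
  "annihilated D N = {b \<in> N. \<forall>P\<in>D. P b = 0}"


section \<open>Modules over rings of differential operators\<close>

text \<open>
  All rings \<open>D\<close> of operators below contain the scalars, so that submodules are automatically
  linear subspaces.
\<close>

definition submod :: "nat \<Rightarrow> (cpoly \<Rightarrow> cpoly) set \<Rightarrow> cpoly set \<Rightarrow> bool" where
  "submod n D N \<longleftrightarrow> cpoly.subspace N \<and> N \<subseteq> polys n \<and> (\<forall>P\<in>D. \<forall>b\<in>N. P b \<in> N)"

definition simple_submod :: "nat \<Rightarrow> (cpoly \<Rightarrow> cpoly) set \<Rightarrow> cpoly set \<Rightarrow> bool" where
  "simple_submod n D N \<longleftrightarrow>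
     submod n D N \<and> N \<noteq> {0} \<and> (\<forall>M. submod n D M \<and> M \<subseteq> N \<longrightarrow> M = {0} \<or> M = N)"

definition mod_iso :: "(cpoly \<Rightarrow> cpoly) set \<Rightarrow> cpoly set \<Rightarrow> cpoly set \<Rightarrow> bool" where
  "mod_iso D M N \<longleftrightarrow>
     (\<exists>f. bij_betw f M N \<and> (\<forall>a\<in>M. \<forall>b\<in>M. f (a + b) = f a + f b) \<and>
        (\<forall>P\<in>D. \<forall>b\<in>M. f (P b) = P (f b)))"

definition mod_component :: "nat \<Rightarrow> (cpoly \<Rightarrow> cpoly) set \<Rightarrow> cpoly set \<Rightarrow> cpoly set" where
  "mod_component n D N = cpoly.span (\<Union>{M. simple_submod n D M \<and> mod_iso D M N})"

definition generated :: "(cpoly \<Rightarrow> cpoly) set \<Rightarrow> cpoly set \<Rightarrow> cpoly set" where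
  "generated D S = cpoly.span {P b | P b. P \<in> D \<and> b \<in> S}"

text \<open>The relation \<open>N \<sim>\<^sub>K U\<close>, including the requirements that make it meaningful.\<close>

definition corresponds ::
  "nat \<Rightarrow> complex mat set \<Rightarrow> cpoly set \<Rightarrow> (complex mat, 'w::ab_group_add) rep \<Rightarrow> bool" where
  "corresponds n K N U \<longleftrightarrow>
     simple_submod n (weyl_inv n K) N \<and> irreducible_rep (mat_group n K) U \<and>
     rep_component n K U = mod_component n (weyl_inv n K) N"


section \<open>MLS-restriction and MLS-induction\<close>

definition N_ann :: "nat \<Rightarrow> complex mat set \<Rightarrow> cpoly set \<Rightarrow> cpoly set" where
  "N_ann n H N = annihilated (neg_part n (weyl_inv n H)) N"

definition mls_res ::
  "nat \<Rightarrow> complex mat set \<Rightarrow> complex mat set \<Rightarrow> cpoly set \<Rightarrow> cpoly set" where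
  "mls_res n G H N = generated (weyl_inv n G) (N_ann n H N)"

definition mls_deg ::
  "nat \<Rightarrow> complex mat set \<Rightarrow> (complex mat, 'w::ab_group_add) rep \<Rightarrow> nat" where
  "mls_deg n H W = (LEAST d. rep_component n H W \<inter> hom_polys n d \<noteq> {0})"

definition mls_ind ::
  "nat \<Rightarrow> complex mat set \<Rightarrow> complex mat set \<Rightarrow> (complex mat, 'w::ab_group_add) rep \<Rightarrow> cpoly set"
  where
  "mls_ind n G H W = cpoly.span {act g b | g b.
     g \<in> G \<and> b \<in> rep_component n H W \<inter> hom_polys n (mls_deg n H W)}"

end

theory Submission
  imports Defs "HOL-Algebra.Coset" "HOL-Computational_Algebra.Fundamental_Theorem_Algebra"
begin

text \<open>
  The proof rests on one fact about differential operators, density: on polynomials of bounded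
  degree every linear map is given by an element of the Weyl algebra (\<open>density\<close>). Averaging over a
  finite group \<open>K\<close>, one finds that every \<open>K\<close>-equivariant map is given by an invariant operator, with
  control of the degree (\<open>averaged_density\<close>, \<open>averaged_density_homog\<close>). In particular there are
  invariant operators that project onto a given \<open>K\<close>-stable subspace, which plays the part of Maschke's
  theorem.

  The theorem is then a matter of comparing \<open>\<D>\<^sup>K\<close>-modules with \<open>K\<close>-representations. A
  \<open>\<D>\<^sup>K\<close>-linear map sends \<open>b\<close> into the span \<open>\<complex>[K] b\<close> of its orbit, so the isotypic component of
  a simple \<open>N\<close> is \<open>\<complex>[K] N\<close> (\<open>mod_component_eq_gspan\<close>), and the vectors of \<open>N\<close> that operators of
  negative degree annihilate are those of lowest degree (\<open>N_ann_eq\<close>). With \<open>A = N\<^sup>a\<^sup>n\<^sup>n\<close> this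
  gives \<open>B_W = \<complex>[H] N\<close> and hence \<open>j(W) = \<complex>[G] A\<close>, while \<open>J(N) = \<D>\<^sub>2 A\<close> by definition. So
  both objects depend only on \<open>A\<close>, a simple module over the \<open>G\<close>-invariant operators of degree zero.

  For \<open>0 \<noteq> a \<in> A\<close> the representation \<open>W\<^sub>1 = \<complex>[G] a\<close> is irreducible (\<open>irred_orbit\<close>). By Schur's
  lemma, linearly independent vectors of \<open>A\<close> generate independent subrepresentations
  (\<open>A_Int_gspan\<close>), all isomorphic to \<open>W\<^sub>1\<close>, so that \<open>\<complex>[G] A\<close> is the sum of \<open>r\<close> copies of \<open>W\<^sub>1\<close>
  (\<open>gspan_A_iso\<close>). An invariant operator that does not kill \<open>a\<close> is invertible on \<open>W\<^sub>1\<close> with an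
  inverse of the same kind; therefore \<open>\<D>\<^sub>2 A\<close> is simple, and it belongs to \<open>W\<^sub>1\<close>
  (\<open>generated_simple\<close>, \<open>generated_corresponds\<close>). For \<open>r = 1\<close> one has \<open>\<complex>[G] A = W\<^sub>1\<close>.
\<close>

section \<open>Linear maps and monomials\<close>

abbreviation lin :: "(cpoly \<Rightarrow> cpoly) \<Rightarrow> bool" where
  "lin \<equiv> Vector_Spaces.linear smul smul"

interpretation cpoly_pair: vector_space_pair smul smul
  by unfold_locales

lemma linI:
  assumes "\<And>a b. f (a + b) = f a + f b" "\<And>c a. f (smul c a) = smul c (f a)"
  shows "lin f"
  using assms by unfold_locales auto

lemma lin_add: "lin f \<Longrightarrow> f (a + b) = f a + f b"
  by (rule cpoly_pair.linear_add)

lemma lin_smul: "lin f \<Longrightarrow> f (smul c a) = smul c (f a)"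
  by (rule cpoly_pair.linear_scale)

lemma lin_0: "lin f \<Longrightarrow> f 0 = 0"
  by (rule cpoly_pair.linear_0)

lemma lin_diff: "lin f \<Longrightarrow> f (a - b) = f a - f b"
  by (rule cpoly_pair.linear_diff)

lemma lin_sum: "lin f \<Longrightarrow> f (\<Sum>i\<in>S. h i) = (\<Sum>i\<in>S. f (h i))"
  by (rule cpoly_pair.linear_sum)

lemma lin_comp: "lin f \<Longrightarrow> lin g \<Longrightarrow> lin (\<lambda>b. f (g b))"
  by (rule linI) (simp_all add: lin_add lin_smul)

lemma lin_plus: "lin f \<Longrightarrow> lin g \<Longrightarrow> lin (\<lambda>b. f b + g b)"
  by (rule linI) (simp_all add: lin_add lin_smul algebra_simps cpoly.scale_right_distrib)

lemma lin_scale: "lin (smul c)"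
  by (rule linI) (simp_all add: cpoly.scale_right_distrib mult.commute)

lemma lin_id: "lin (\<lambda>b. b)"
  by (rule linI) simp_all

lemma lin_zero: "lin (\<lambda>b. 0)"
  by (rule linI) simp_all

lemma smul_mult_left: "smul c p * q = smul c (p * q)"
  by (simp add: smul_def mult.assoc)

lemma smul_mult_right: "p * smul c q = smul c (p * q)"
  by (simp add: smul_def mult.left_commute)

lemma lin_times: "lin (\<lambda>b. q * b)"
  by (rule linI) (simp_all add: smul_mult_right algebra_simps)

lemma lin_times_right: "lin (\<lambda>b. b * q)"
  by (rule linI) (simp_all add: smul_mult_left distrib_right)

lemma lin_lsum: "(\<And>i. i \<in> S \<Longrightarrow> lin (f i)) \<Longrightarrow> lin (\<lambda>b. \<Sum>i\<in>S. f i b)"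
  by (rule linI) (simp_all add: lin_add lin_smul sum.distrib cpoly.scale_sum_right)

lemma lin_subspace_vimage:
  assumes "lin f" "cpoly.subspace S"
  shows "cpoly.subspace {b. f b \<in> S}"
  using assms
  by (auto simp: cpoly.subspace_def lin_add lin_smul lin_0)

lemma lin_subspace_image:
  assumes "lin f" "cpoly.subspace S"
  shows "cpoly.subspace (f ` S)"
proof -
  interpret f: Vector_Spaces.linear smul smul f by fact
  show ?thesis by (rule f.subspace_image[OF assms(2)])
qed

lemma lookup_smul: "Poly_Mapping.lookup (smul c p) m = c * Poly_Mapping.lookup p m"
  unfolding smul_def by (subst mult_map_scale_conv_mult[symmetric]) (simp add: map.rep_eq when_def)

definition monomial :: "(nat \<Rightarrow>\<^sub>0 nat) \<Rightarrow> cpoly" where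
  "monomial m = Poly_Mapping.single m 1"

lemma monomial_add: "monomial (m + k) = monomial m * monomial k"
  by (simp add: monomial_def mult_single)

lemma monomial_0: "monomial 0 = 1"
  by (simp add: monomial_def)

lemma X_monomial: "X i = monomial (Poly_Mapping.single i 1)"
  by (simp add: monomial_def X_def)

lemma keys_monomial [simp]: "Poly_Mapping.keys (monomial m) = {m}"
  by (simp add: monomial_def)

lemma lookup_monomial: "Poly_Mapping.lookup (monomial m) k = (if m = k then 1 else 0)"
  by (simp add: monomial_def lookup_single when_def)

lemma poly_eq_sum_monomial:
  assumes "finite S" "Poly_Mapping.keys p \<subseteq> S"
  shows "p = (\<Sum>m\<in>S. smul (Poly_Mapping.lookup p m) (monomial m))"
proof (rule poly_mapping_eqI)
  fix k
  have "Poly_Mapping.lookup (\<Sum>m\<in>S. smul (Poly_Mapping.lookup p m) (monomial m)) k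
      = (\<Sum>m\<in>S. if m = k then Poly_Mapping.lookup p k else 0)"
    by (auto simp: lookup_sum lookup_smul lookup_monomial intro!: sum.cong)
  also have "\<dots> = Poly_Mapping.lookup p k"
    using assms by (auto simp: sum.delta in_keys_iff)
  finally show "Poly_Mapping.lookup p k = Poly_Mapping.lookup (\<Sum>m\<in>S. smul (Poly_Mapping.lookup p m) (monomial m)) k" ..
qed

text \<open>
  The linear map with prescribed values on monomials. The substitution \<open>act g\<close> and the
  derivation \<open>pd i\<close> are both of this form, so that their linearity is proved only once.
\<close>

definition lin_ext :: "((nat \<Rightarrow>\<^sub>0 nat) \<Rightarrow> cpoly) \<Rightarrow> cpoly \<Rightarrow> cpoly" where
  "lin_ext F p = (\<Sum>m\<in>Poly_Mapping.keys p. smul (Poly_Mapping.lookup p m) (F m))"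

lemma lin_ext_superset:
  assumes "finite S" "Poly_Mapping.keys p \<subseteq> S"
  shows "lin_ext F p = (\<Sum>m\<in>S. smul (Poly_Mapping.lookup p m) (F m))"
  unfolding lin_ext_def using assms
  by (intro sum.mono_neutral_left) (auto simp: in_keys_iff)

lemma lin_lin_ext: "lin (lin_ext F)"
proof (rule linI)
  fix a b :: cpoly and c
  let ?S = "Poly_Mapping.keys a \<union> Poly_Mapping.keys b"
  have "lin_ext F (a + b) = (\<Sum>m\<in>?S. smul (Poly_Mapping.lookup (a + b) m) (F m))"
    by (rule lin_ext_superset) (use keys_add[of a b] in auto)
  also have "\<dots> = lin_ext F a + lin_ext F b"
    by (simp add: lin_ext_superset[of ?S a] lin_ext_superset[of ?S b] lookup_add
        cpoly.scale_left_distrib sum.distrib)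
  finally show "lin_ext F (a + b) = lin_ext F a + lin_ext F b" .
  have "lin_ext F (smul c a) = (\<Sum>m\<in>Poly_Mapping.keys a. smul (Poly_Mapping.lookup (smul c a) m) (F m))"
    by (rule lin_ext_superset) (auto simp: in_keys_iff lookup_smul)
  also have "\<dots> = smul c (lin_ext F a)"
    by (simp add: lin_ext_def lookup_smul cpoly.scale_sum_right)
  finally show "lin_ext F (smul c a) = smul c (lin_ext F a)" .
qed

lemma lin_ext_monomial: "lin_ext F (monomial m) = F m"
  by (simp add: lin_ext_def lookup_monomial)

lemma lin_eq_on_keys:
  assumes "lin f" "lin g" "\<And>m. m \<in> Poly_Mapping.keys p \<Longrightarrow> f (monomial m) = g (monomial m)"
  shows "f p = g p"
proof -
  have p: "p = (\<Sum>m\<in>Poly_Mapping.keys p. smul (Poly_Mapping.lookup p m) (monomial m))" (is "p = ?s")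
    by (rule poly_eq_sum_monomial) auto
  have "f ?s = g ?s"
    using assms by (simp add: lin_sum lin_smul)
  then show ?thesis using p by simp
qed

lemma lin_in_subspace:
  assumes "lin f" "cpoly.subspace S" "\<And>m. m \<in> Poly_Mapping.keys p \<Longrightarrow> f (monomial m) \<in> S"
  shows "f p \<in> S"
proof -
  have p: "p = (\<Sum>m\<in>Poly_Mapping.keys p. smul (Poly_Mapping.lookup p m) (monomial m))" (is "p = ?s")
    by (rule poly_eq_sum_monomial) auto
  have "f ?s \<in> S"
    using assms by (auto simp: lin_sum lin_smul intro!: cpoly.subspace_sum cpoly.subspace_scale)
  then show ?thesis using p by simp
qed

lemma subspace_keys: "cpoly.subspace {p. \<forall>m\<in>Poly_Mapping.keys p. Q m}"
proof (rule cpoly.subspaceI)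
  fix a b :: cpoly
  assume "a \<in> {p. \<forall>m\<in>Poly_Mapping.keys p. Q m}" "b \<in> {p. \<forall>m\<in>Poly_Mapping.keys p. Q m}"
  then show "a + b \<in> {p. \<forall>m\<in>Poly_Mapping.keys p. Q m}"
    using keys_add[of a b] by blast
qed (auto simp: in_keys_iff lookup_smul)

lemma subspace_polys: "cpoly.subspace (polys n)"
  unfolding polys_def by (rule subspace_keys)

lemma hom_polys_eq: "hom_polys n d =
    {p. \<forall>m\<in>Poly_Mapping.keys p. Poly_Mapping.keys m \<subseteq> {..<n} \<and> mdeg m = d}"
  by (auto simp: hom_polys_def polys_def)

lemma subspace_hom: "cpoly.subspace (hom_polys n d)"
  unfolding hom_polys_eq by (rule subspace_keys)

text \<open>
  The Weyl algebra realises every linear map of \<open>B\<close> only up to a given degree, so elements and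
  subspaces have to be placed in a space of polynomials of bounded degree first.
\<close>

definition bdd_polys :: "nat \<Rightarrow> nat \<Rightarrow> cpoly set" where
  "bdd_polys n D = {p. \<forall>m\<in>Poly_Mapping.keys p. Poly_Mapping.keys m \<subseteq> {..<n} \<and> mdeg m \<le> D}"

lemma subspace_bdd: "cpoly.subspace (bdd_polys n D)"
  unfolding bdd_polys_def by (rule subspace_keys)

lemma hom_subset_polys: "hom_polys n d \<subseteq> polys n"
  by (auto simp: hom_polys_def)

lemma bdd_subset_polys: "bdd_polys n d \<subseteq> polys n"
  by (auto simp: bdd_polys_def polys_def)

lemma hom_subset_bdd: "d \<le> D \<Longrightarrow> hom_polys n d \<subseteq> bdd_polys n D"
  by (auto simp: bdd_polys_def hom_polys_eq)

lemma polys_bdd: "p \<in> polys n \<Longrightarrow> \<exists>D. p \<in> bdd_polys n D"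
  by (rule exI[of _ "Max (mdeg ` Poly_Mapping.keys p)"]) (auto simp: polys_def bdd_polys_def)

lemma bdd_mono: "d \<le> D \<Longrightarrow> bdd_polys n d \<subseteq> bdd_polys n D"
  by (auto simp: bdd_polys_def intro: order_trans)

lemma finite_bdd:
  assumes "finite S" "S \<subseteq> polys n"
  shows "\<exists>D. S \<subseteq> bdd_polys n D"
  using assms
proof (induction S)
  case (insert x S)
  then obtain D E where "S \<subseteq> bdd_polys n D" "x \<in> bdd_polys n E"
    using polys_bdd by blast
  then have "insert x S \<subseteq> bdd_polys n (max D E)"
    using bdd_mono[of D "max D E" n] bdd_mono[of E "max D E" n] by auto
  then show ?case ..
qed auto

lemma mdeg_superset: "finite S \<Longrightarrow> Poly_Mapping.keys m \<subseteq> S \<Longrightarrow> mdeg m = (\<Sum>i\<in>S. Poly_Mapping.lookup m i)"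
  unfolding mdeg_def by (rule sum.mono_neutral_left) (auto simp: in_keys_iff)

lemma mdeg_add: "mdeg (m + k) = mdeg m + mdeg k"
proof -
  let ?S = "Poly_Mapping.keys m \<union> Poly_Mapping.keys k"
  have "mdeg (m + k) = (\<Sum>i\<in>?S. Poly_Mapping.lookup (m + k) i)"
    by (rule mdeg_superset) (use keys_add[of m k] in auto)
  then show ?thesis
    by (simp add: mdeg_superset[of ?S m] mdeg_superset[of ?S k] lookup_add sum.distrib)
qed

lemma mdeg_single [simp]: "mdeg (Poly_Mapping.single i c) = c"
  by (simp add: mdeg_def)

lemma mdeg_0 [simp]: "mdeg 0 = 0"
  by (simp add: mdeg_def)

lemma mdeg_eq_0: "mdeg m = 0 \<longleftrightarrow> m = 0"
  by (auto simp: mdeg_def in_keys_iff intro!: poly_mapping_eqI)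

lemma finite_monomials: "finite {m. Poly_Mapping.keys m \<subseteq> {..<n} \<and> mdeg m \<le> D}" (is "finite ?M")
proof (rule finite_imageD)
  have "Poly_Mapping.lookup m i \<le> D" if "mdeg m \<le> D" for m i
  proof (cases "i \<in> Poly_Mapping.keys m")
    case True
    then have "Poly_Mapping.lookup m i \<le> mdeg m"
      unfolding mdeg_def by (intro member_le_sum) auto
    then show ?thesis using that by simp
  qed (simp add: in_keys_iff)
  then have "Poly_Mapping.lookup ` ?M
      \<subseteq> {f. \<forall>i. (i \<in> {..<n} \<longrightarrow> f i \<in> {..D}) \<and> (i \<notin> {..<n} \<longrightarrow> f i = 0)}"
    by (auto simp: in_keys_iff)
  then show "finite (Poly_Mapping.lookup ` ?M)"
    by (rule finite_subset) (rule finite_set_of_finite_funs, auto)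
  show "inj_on Poly_Mapping.lookup ?M"
    by (rule inj_onI) (simp only: poly_mapping_eq_iff)
qed

text \<open>
  Every identity between operators on \<open>B\<close> that is compatible with multiplication by a variable
  is checked by this induction.
\<close>

lemma monomial_induct [consumes 1, case_names zero add]:
  fixes m :: "nat \<Rightarrow>\<^sub>0 nat"
  assumes "Poly_Mapping.keys m \<subseteq> {..<n}"
    and z: "P 0"
    and s: "\<And>i m. i < n \<Longrightarrow> Poly_Mapping.keys m \<subseteq> {..<n} \<Longrightarrow> P m \<Longrightarrow> P (Poly_Mapping.single i 1 + m)"
  shows "P m"
  using assms(1)
proof (induction "mdeg m" arbitrary: m)
  case 0
  then show ?case using z mdeg_eq_0 by metis
next
  case (Suc d)
  then obtain i where i: "i \<in> Poly_Mapping.keys m"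
    by (metis mdeg_def sum.empty all_not_in_conv Zero_not_Suc)
  define k where "k = m - Poly_Mapping.single i 1"
  have m: "m = Poly_Mapping.single i 1 + k"
    using i by (intro poly_mapping_eqI) (auto simp: k_def lookup_add lookup_minus lookup_single in_keys_iff when_def)
  have "Poly_Mapping.keys k \<subseteq> Poly_Mapping.keys m"
    by (auto simp: k_def in_keys_iff lookup_minus)
  moreover have "mdeg k = d"
    using Suc.hyps(2) m by (simp add: mdeg_add)
  ultimately have "P k"
    using Suc by auto
  then show ?case
    unfolding m using i Suc.prems \<open>Poly_Mapping.keys k \<subseteq> Poly_Mapping.keys m\<close> by (intro s) auto
qed

lemma lin_eq_on_polys:
  assumes "lin f" "lin g" "f 1 = g 1"
    and "\<And>i q. i < n \<Longrightarrow> q \<in> polys n \<Longrightarrow> f q = g q \<Longrightarrow> f (X i * q) = g (X i * q)"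
    and "p \<in> polys n"
  shows "f p = g p"
proof (rule lin_eq_on_keys[OF assms(1,2)])
  fix m assume "m \<in> Poly_Mapping.keys p"
  then have "Poly_Mapping.keys m \<subseteq> {..<n}"
    using assms(5) by (auto simp: polys_def)
  then show "f (monomial m) = g (monomial m)"
  proof (induction rule: monomial_induct)
    case zero
    then show ?case using assms(3) by (simp add: monomial_0)
  next
    case (add i m)
    then show ?case unfolding monomial_add X_monomial[symmetric]
      by (intro assms(4)) (auto simp: polys_def)
  qed
qed

lemma mult_keys:
  assumes "\<forall>m\<in>Poly_Mapping.keys p. Q m" "\<forall>m\<in>Poly_Mapping.keys q. R m"
    and "\<And>m k. Q m \<Longrightarrow> R k \<Longrightarrow> T (m + k)"
  shows "\<forall>m\<in>Poly_Mapping.keys (p * q :: cpoly). T m"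
  using keys_mult[of p q] assms by blast

lemma polys_mult: "p \<in> polys n \<Longrightarrow> q \<in> polys n \<Longrightarrow> p * q \<in> polys n"
  unfolding polys_def mem_Collect_eq
  by (erule (1) mult_keys) (metis Un_subset_iff keys_add subset_trans Un_least)

lemma hom_mult: "p \<in> hom_polys n d \<Longrightarrow> q \<in> hom_polys n e \<Longrightarrow> p * q \<in> hom_polys n (d + e)"
  unfolding hom_polys_eq mem_Collect_eq
  by (erule (1) mult_keys) (metis Un_least keys_add mdeg_add subset_trans)

lemma one_hom: "1 \<in> hom_polys n 0"
  by (auto simp: hom_polys_eq)

lemma X_hom: "i < n \<Longrightarrow> X i \<in> hom_polys n 1"
  by (auto simp: hom_polys_eq X_monomial)

lemma X_polys: "i < n \<Longrightarrow> X i \<in> polys n"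
  by (auto simp: polys_def X_monomial)

section \<open>Homogeneous components\<close>

definition hcomp :: "nat \<Rightarrow> cpoly \<Rightarrow> cpoly" where
  "hcomp d = lin_ext (\<lambda>m. if mdeg m = d then monomial m else 0)"

lemma lin_hcomp: "lin (hcomp d)"
  unfolding hcomp_def by (rule lin_lin_ext)

lemma hcomp_monomial: "hcomp d (monomial m) = (if mdeg m = d then monomial m else 0)"
  by (simp add: hcomp_def lin_ext_monomial)

lemma hcomp_hom: "p \<in> polys n \<Longrightarrow> hcomp d p \<in> hom_polys n d"
  by (rule lin_in_subspace[OF lin_hcomp subspace_hom])
    (auto simp: hcomp_monomial hom_polys_eq polys_def)

lemma hcomp_id: "p \<in> hom_polys n d \<Longrightarrow> hcomp d p = p"
  by (rule lin_eq_on_keys[OF lin_hcomp lin_id]) (auto simp: hcomp_monomial hom_polys_eq)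

lemma hcomp_other: "p \<in> hom_polys n e \<Longrightarrow> e \<noteq> d \<Longrightarrow> hcomp d p = 0"
  by (rule lin_eq_on_keys[OF lin_hcomp lin_zero]) (auto simp: hcomp_monomial hom_polys_eq)

lemma hcomp_sum: "p \<in> bdd_polys n D \<Longrightarrow> p = (\<Sum>d\<le>D. hcomp d p)"
  by (rule lin_eq_on_keys[OF lin_id lin_lsum[OF lin_hcomp]])
    (auto simp: hcomp_monomial bdd_polys_def)

lemma finite_independent_hom:
  assumes "B \<subseteq> hom_polys n d" "cpoly.independent B"
  shows "finite B"
proof -
  let ?M = "{m. Poly_Mapping.keys m \<subseteq> {..<n} \<and> mdeg m \<le> d}"
  have "p \<in> cpoly.span (monomial ` ?M)" if "p \<in> bdd_polys n d" for p
    by (rule lin_in_subspace[OF lin_id cpoly.subspace_span])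
      (use that in \<open>auto simp: bdd_polys_def intro: cpoly.span_base\<close>)
  then have "B \<subseteq> cpoly.span (monomial ` ?M)"
    using assms(1) hom_subset_bdd[of d d n] by blast
  then show ?thesis
    using cpoly.independent_span_bound[OF finite_imageI[OF finite_monomials] assms(2)] by blast
qed

section \<open>Linear substitutions\<close>

definition lform :: "complex mat \<Rightarrow> nat \<Rightarrow> cpoly" where
  "lform g j = (\<Sum>i<dim_row g. smul (g $$ (i, j)) (X i))"

lemma act_lin_ext:
  "act g = lin_ext (\<lambda>m. \<Prod>j\<in>Poly_Mapping.keys m. lform g j ^ Poly_Mapping.lookup m j)"
  by (rule ext) (simp add: act_def lin_ext_def lform_def)

lemma lin_act: "lin (act g)"
  unfolding act_lin_ext by (rule lin_lin_ext)

lemma act_monomial: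
  assumes "finite S" "Poly_Mapping.keys m \<subseteq> S"
  shows "act g (monomial m) = (\<Prod>j\<in>S. lform g j ^ Poly_Mapping.lookup m j)"
  unfolding act_lin_ext lin_ext_monomial using assms
  by (intro prod.mono_neutral_left) (auto simp: in_keys_iff)

lemma act_monomial_add: "act g (monomial (m + k)) = act g (monomial m) * act g (monomial k)"
proof -
  let ?S = "Poly_Mapping.keys m \<union> Poly_Mapping.keys k"
  have "act g (monomial (m + k)) = (\<Prod>j\<in>?S. lform g j ^ Poly_Mapping.lookup (m + k) j)"
    by (rule act_monomial) (use keys_add[of m k] in auto)
  then show ?thesis
    by (simp add: act_monomial[of ?S m] act_monomial[of ?S k] lookup_add power_add prod.distrib)
qed

text \<open>
  Both sides are bilinear, so only monomials matter; there the exponents add up.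
\<close>

lemma act_mult: "act g (p * q) = act g p * act g q"
proof (rule lin_eq_on_keys[of "\<lambda>p. act g (p * q)" "\<lambda>p. act g p * act g q"])
  show "lin (\<lambda>p. act g (p * q))" by (rule lin_comp[OF lin_act lin_times_right])
  show "lin (\<lambda>p. act g p * act g q)" by (rule lin_comp[OF lin_times_right lin_act])
  fix m
  show "act g (monomial m * q) = act g (monomial m) * act g q"
    by (rule lin_eq_on_keys[OF lin_comp[OF lin_act lin_times] lin_comp[OF lin_times lin_act]])
      (simp add: act_monomial_add flip: monomial_add)
qed

lemma act_1: "act g 1 = 1"
  using act_monomial[of "{}" 0 g] by (simp add: monomial_0)

lemma act_X: "act g (X j) = lform g j"
  unfolding X_monomial by (subst act_monomial[of "{j}"]) (auto simp: lookup_single split: if_splits)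

lemma lform_hom: "g \<in> carrier_mat n n \<Longrightarrow> lform g j \<in> hom_polys n 1"
  unfolding lform_def
  by (intro cpoly.subspace_sum[OF subspace_hom] cpoly.subspace_scale[OF subspace_hom] X_hom) auto

lemma act_monomial_hom:
  assumes g: "g \<in> carrier_mat n n" and "Poly_Mapping.keys m \<subseteq> {..<n}"
  shows "act g (monomial m) \<in> hom_polys n (mdeg m)"
  using assms(2)
proof (induction rule: monomial_induct)
  case zero
  show ?case by (simp add: monomial_0 act_1 one_hom)
next
  case (add i m)
  have "act g (monomial (Poly_Mapping.single i 1 + m)) = lform g i * act g (monomial m)"
    by (simp only: act_monomial_add act_X flip: X_monomial)
  then show ?case
    using hom_mult[OF lform_hom[OF g] add(3), of i] by (simp add: mdeg_add)
qed

lemma act_hom: "g \<in> carrier_mat n n \<Longrightarrow> p \<in> hom_polys n d \<Longrightarrow> act g p \<in> hom_polys n d"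
proof (rule lin_in_subspace[OF lin_act subspace_hom])
  fix m assume "g \<in> carrier_mat n n" "p \<in> hom_polys n d" "m \<in> Poly_Mapping.keys p"
  then show "act g (monomial m) \<in> hom_polys n d"
    using act_monomial_hom[of g n m] by (simp add: hom_polys_eq)
qed

lemma act_bdd: "g \<in> carrier_mat n n \<Longrightarrow> p \<in> bdd_polys n d \<Longrightarrow> act g p \<in> bdd_polys n d"
proof (rule lin_in_subspace[OF lin_act subspace_bdd])
  fix m assume "g \<in> carrier_mat n n" "p \<in> bdd_polys n d" "m \<in> Poly_Mapping.keys p"
  then show "act g (monomial m) \<in> bdd_polys n d"
    using act_monomial_hom[of g n m] hom_subset_bdd[of "mdeg m" d n] by (auto simp: bdd_polys_def)
qed

lemma act_polys: "g \<in> carrier_mat n n \<Longrightarrow> p \<in> polys n \<Longrightarrow> act g p \<in> polys n"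
  using polys_bdd act_bdd bdd_subset_polys by blast

text \<open>
  Algebra homomorphisms that agree on the variables are equal; on the variables the claim is the
  formula for the entries of a matrix product.
\<close>

lemma act_comp:
  assumes g: "g \<in> carrier_mat n n" and h: "h \<in> carrier_mat n n" and p: "p \<in> polys n"
  shows "act (g * h) p = act g (act h p)"
  using p
proof (rule lin_eq_on_polys[OF lin_act lin_comp[OF lin_act lin_act], rotated 2])
  fix j q assume j: "j < n" and IH: "act (g * h) q = act g (act h q)"
  have "lform (g * h) j = (\<Sum>i<n. \<Sum>k<n. smul (g $$ (i, k) * h $$ (k, j)) (X i))"
    using g h j by (auto simp: lform_def scalar_prod_def cpoly.scale_sum_left atLeast0LessThan intro!: sum.cong)
  also have "\<dots> = (\<Sum>k<n. \<Sum>i<n. smul (g $$ (i, k) * h $$ (k, j)) (X i))"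
    by (rule sum.swap)
  also have "\<dots> = (\<Sum>k<n. smul (h $$ (k, j)) (lform g k))"
    using g by (auto simp: lform_def cpoly.scale_sum_right mult.commute intro!: sum.cong)
  also have "\<dots> = act g (lform h j)"
    using h by (simp add: lform_def lin_sum[OF lin_act] lin_smul[OF lin_act] act_X)
  finally show "act (g * h) (X j * q) = act g (act h (X j * q))"
    by (simp add: act_mult act_X IH)
qed (simp add: act_1)

lemma act_id: "p \<in> polys n \<Longrightarrow> act (1\<^sub>m n) p = p"
proof (rule lin_eq_on_polys[OF lin_act lin_id])
  fix j q assume j: "j < n" and IH: "act (1\<^sub>m n) q = q"
  have "lform (1\<^sub>m n) j = (\<Sum>i<n. if i = j then X i else 0)"
    unfolding lform_def by (rule sum.cong) (use j in auto)
  then show "act (1\<^sub>m n) (X j * q) = X j * q"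
    using j IH by (simp add: act_mult act_X)
qed (auto simp: act_1)

section \<open>Derivations and differential operators\<close>

lemma smul_monomial: "smul c (monomial m) = Poly_Mapping.single m c"
  by (simp add: smul_def monomial_def mult_single)

lemma pd_lin_ext:
  "pd i = lin_ext (\<lambda>m. smul (of_nat (Poly_Mapping.lookup m i)) (monomial (m - Poly_Mapping.single i 1)))"
  by (rule ext) (simp only: pd_def lin_ext_def cpoly.scale_scale mult.commute flip: smul_monomial)

lemma lin_pd: "lin (pd i)"
  unfolding pd_lin_ext by (rule lin_lin_ext)

lemma pd_monomial: "pd i (monomial m) = smul (of_nat (Poly_Mapping.lookup m i)) (monomial (m - Poly_Mapping.single i 1))"
  by (simp add: pd_lin_ext lin_ext_monomial)

lemma monomial_diff_add:
  "Poly_Mapping.lookup m i \<noteq> 0 \<Longrightarrow> Poly_Mapping.single i 1 + (m - Poly_Mapping.single i (1::nat)) = m"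
  by (rule poly_mapping_eqI) (auto simp: lookup_add lookup_minus lookup_single when_def)

text \<open>
  The Leibniz rule for a product with a variable. The monomials without \<open>x\<^sub>i\<close> are treated
  separately because of the truncated subtraction in the exponent.
\<close>

lemma pd_X_mult: "pd i (X k * q) = (if i = k then q else 0) + X k * pd i q"
proof (rule lin_eq_on_keys[of "\<lambda>q. pd i (X k * q)" "\<lambda>q. (if i = k then q else 0) + X k * pd i q"])
  show "lin (\<lambda>q. pd i (X k * q))" by (rule lin_comp[OF lin_pd lin_times])
  show "lin (\<lambda>q. (if i = k then q else 0) + X k * pd i q)"
    by (cases "i = k") (simp_all add: lin_plus lin_comp[OF lin_times lin_pd] lin_id lin_zero)
  fix m :: "nat \<Rightarrow>\<^sub>0 nat"
  let ?e = "\<lambda>i. Poly_Mapping.single i (1::nat)"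
  have L: "pd i (X k * monomial m) = smul (of_nat (Poly_Mapping.lookup (?e k + m) i)) (monomial (?e k + m - ?e i))"
    unfolding X_monomial by (simp only: pd_monomial flip: monomial_add)
  have R: "X k * pd i (monomial m) = smul (of_nat (Poly_Mapping.lookup m i)) (monomial (?e k + (m - ?e i)))"
    unfolding X_monomial by (simp only: pd_monomial smul_mult_right flip: monomial_add)
  show "pd i (X k * monomial m) = (if i = k then monomial m else 0) + X k * pd i (monomial m)"
  proof (cases "Poly_Mapping.lookup m i = 0")
    case True
    then show ?thesis unfolding L R by (auto simp: lookup_add lookup_single)
  next
    case False
    then have "?e k + m - ?e i = ?e k + (m - ?e i)"
      by (intro poly_mapping_eqI) (auto simp: lookup_add lookup_minus lookup_single when_def)
    with False show ?thesis unfolding L R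
      using monomial_diff_add[OF False]
      by (auto simp: lookup_add lookup_single cpoly.scale_left_distrib add.commute)
  qed
qed

lemma pd_1: "pd i 1 = 0"
  by (simp add: pd_monomial flip: monomial_0)

text \<open>
  The grading of \<open>B\<close>, indexed by integers: negative degrees vanish. In this form an operator of
  degree \<open>k\<close> always shifts the degree by \<open>k\<close>.
\<close>

definition homz :: "nat \<Rightarrow> int \<Rightarrow> cpoly set" where
  "homz n e = (if e < 0 then {0} else hom_polys n (nat e))"

lemma homz_of_nat [simp]: "homz n (int d) = hom_polys n d"
  by (simp add: homz_def)

lemma subspace_homz: "cpoly.subspace (homz n e)"
  by (simp add: homz_def subspace_hom cpoly.subspace_0 cpoly.subspace_single_0)

lemma pd_homz: "p \<in> homz n e \<Longrightarrow> pd i p \<in> homz n (e - 1)"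
proof (cases "e < 0")
  case True
  then show "p \<in> homz n e \<Longrightarrow> pd i p \<in> homz n (e - 1)"
    by (simp add: homz_def lin_0[OF lin_pd])
next
  case False
  then obtain d where e: "e = int d" by (metis nat_0_le not_le)
  assume "p \<in> homz n e"
  then have p: "p \<in> hom_polys n d" by (simp add: e)
  show ?thesis
  proof (rule lin_in_subspace[OF lin_pd subspace_homz])
    fix m assume "m \<in> Poly_Mapping.keys p"
    then have m: "Poly_Mapping.keys m \<subseteq> {..<n}" "mdeg m = d" using p by (auto simp: hom_polys_eq)
    show "pd i (monomial m) \<in> homz n (e - 1)"
    proof (cases "Poly_Mapping.lookup m i = 0")
      case True
      then show ?thesis by (simp add: pd_monomial cpoly.subspace_0[OF subspace_homz])
    next
      case False
      from arg_cong[OF monomial_diff_add[OF False], of mdeg] have d: "Suc (mdeg (m - Poly_Mapping.single i 1)) = d"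
        using m by (simp add: mdeg_add)
      then have "e - 1 = int (mdeg (m - Poly_Mapping.single i 1))" using e by simp
      moreover have "Poly_Mapping.keys (m - Poly_Mapping.single i 1) \<subseteq> Poly_Mapping.keys m"
        by (auto simp: in_keys_iff lookup_minus)
      then have "Poly_Mapping.keys (m - Poly_Mapping.single i 1) \<subseteq> {..<n}"
        using m by blast
      then have "monomial (m - Poly_Mapping.single i 1) \<in> hom_polys n (mdeg (m - Poly_Mapping.single i 1))"
        by (simp add: hom_polys_eq)
      ultimately show ?thesis
        unfolding pd_monomial by (simp only: homz_of_nat cpoly.subspace_scale[OF subspace_hom])
    qed
  qed
qed

lemma smul_0_fun: "(\<lambda>b. 0) = smul 0"
  by (rule ext) simp

lemma weyl_homog_imp_weyl: "weyl_homog n k P \<Longrightarrow> P \<in> weyl n"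
  by (induction rule: weyl_homog.induct) (auto intro: weyl.intros simp: smul_0_fun)

lemma weyl_lin: "P \<in> weyl n \<Longrightarrow> lin P"
  by (induction rule: weyl.induct) (auto intro: lin_scale lin_times lin_pd lin_plus lin_comp)

lemma homz_X: "p \<in> homz n e \<Longrightarrow> i < n \<Longrightarrow> X i * p \<in> homz n (e + 1)"
  using hom_mult[OF X_hom[of i n], of p "nat e"] cpoly.subspace_0[OF subspace_hom, of n]
  by (auto simp: homz_def nat_add_distrib split: if_splits)

lemma weyl_homog_homz: "weyl_homog n k P \<Longrightarrow> p \<in> homz n e \<Longrightarrow> P p \<in> homz n (e + k)"
proof (induction arbitrary: p e rule: weyl_homog.induct)
  case (comp k P l Q)
  from comp.IH(1)[OF comp.IH(2)[OF comp.prems]] show ?case by (simp add: algebra_simps)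
qed (auto intro: cpoly.subspace_0 cpoly.subspace_scale cpoly.subspace_add subspace_homz homz_X
    dest: pd_homz)

lemma polys_eq_sum_hom: "p \<in> polys n \<Longrightarrow> \<exists>D. p = (\<Sum>d\<le>D. hcomp d p)"
  using polys_bdd hcomp_sum by blast

lemma pd_polys: assumes "p \<in> polys n" shows "pd i p \<in> polys n"
proof -
  obtain D where D: "p = (\<Sum>d\<le>D. hcomp d p)" using polys_eq_sum_hom[OF assms] ..
  have "pd i (hcomp d p) \<in> polys n" for d
    using pd_homz[of "hcomp d p" n "int d" i] hcomp_hom[OF assms] hom_subset_polys[of n] cpoly.subspace_0[OF subspace_polys]
    by (auto simp: homz_def split: if_splits)
  then have "(\<Sum>d\<le>D. pd i (hcomp d p)) \<in> polys n"
    by (intro cpoly.subspace_sum[OF subspace_polys])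
  then have "pd i (\<Sum>d\<le>D. hcomp d p) \<in> polys n"
    by (simp only: lin_sum[OF lin_pd])
  then show ?thesis by (simp only: D[symmetric])
qed

lemma weyl_polys: "P \<in> weyl n \<Longrightarrow> p \<in> polys n \<Longrightarrow> P p \<in> polys n"
  by (induction arbitrary: p rule: weyl.induct)
    (auto intro: cpoly.subspace_scale cpoly.subspace_add subspace_polys pd_polys polys_mult X_polys)

lemma weyl_zero: "(\<lambda>b. 0) \<in> weyl n"
  unfolding smul_0_fun by (rule weyl.scalar)

lemma weyl_sum: "finite S \<Longrightarrow> (\<And>i. i \<in> S \<Longrightarrow> P i \<in> weyl n) \<Longrightarrow> (\<lambda>b. \<Sum>i\<in>S. P i b) \<in> weyl n"
  by (induction S rule: finite_induct) (auto intro: weyl.add weyl_zero)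

lemma weyl_homog_sum:
  "finite S \<Longrightarrow> (\<And>i. i \<in> S \<Longrightarrow> weyl_homog n k (P i)) \<Longrightarrow> weyl_homog n k (\<lambda>b. \<Sum>i\<in>S. P i b)"
  by (induction S rule: finite_induct) (auto intro: weyl_homog.add weyl_homog.zero)

lemma weyl_homog_smul: "weyl_homog n k P \<Longrightarrow> weyl_homog n k (\<lambda>b. smul c (P b))"
  using weyl_homog.comp[OF weyl_homog.scalar] by simp

lemma weyl_homog_mult:
  assumes "q \<in> hom_polys n e"
  shows "weyl_homog n (int e) (\<lambda>b. q * b)"
proof -
  have 1: "weyl_homog n (int (mdeg m)) (\<lambda>b. monomial m * b)" if "Poly_Mapping.keys m \<subseteq> {..<n}" for m
    using that
  proof (induction rule: monomial_induct)
    case zero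
    have "(\<lambda>b. b) = smul 1" by auto
    then show ?case using weyl_homog.scalar[of n 1] by (simp add: monomial_0)
  next
    case (add i m)
    show ?case
      using weyl_homog.comp[OF weyl_homog.var[OF add(1)] add(3)]
      by (simp add: monomial_add mdeg_add mult.assoc X_monomial)
  qed
  have "q * b = (\<Sum>m\<in>Poly_Mapping.keys q. smul (Poly_Mapping.lookup q m) (monomial m * b))" for b
    by (subst poly_eq_sum_monomial[of "Poly_Mapping.keys q" q]) (auto simp: sum_distrib_right smul_mult_left)
  then show ?thesis
    using assms 1 by (auto intro!: weyl_homog_sum weyl_homog_smul simp: hom_polys_eq)
qed

lemma weyl_mult: assumes "q \<in> polys n" shows "(\<lambda>b. q * b) \<in> weyl n"
proof -
  obtain D where D: "q = (\<Sum>d\<le>D. hcomp d q)" using polys_eq_sum_hom[OF assms] ..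
  have "(\<lambda>b. \<Sum>d\<le>D. hcomp d q * b) \<in> weyl n"
    by (intro weyl_sum weyl_homog_imp_weyl[OF weyl_homog_mult[OF hcomp_hom[OF assms]]]) auto
  then show ?thesis by (simp flip: sum_distrib_right D)
qed

lemma pd_lform_mult:
  assumes "g \<in> carrier_mat n n" "i < n"
  shows "pd i (lform g j * q) = smul (g $$ (i, j)) q + lform g j * pd i q"
proof -
  have "pd i (lform g j * q) = (\<Sum>k<n. smul (g $$ (k, j)) (pd i (X k * q)))"
    using assms by (simp add: lform_def sum_distrib_right smul_mult_left lin_sum[OF lin_pd] lin_smul[OF lin_pd])
  also have "\<dots> = (\<Sum>k<n. (if k = i then smul (g $$ (i, j)) q else 0) + smul (g $$ (k, j)) (X k) * pd i q)"
    by (intro sum.cong) (auto simp: pd_X_mult cpoly.scale_right_distrib smul_mult_left)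
  also have "\<dots> = smul (g $$ (i, j)) q + lform g j * pd i q"
    using assms by (simp add: sum.distrib lform_def sum_distrib_right)
  finally show ?thesis .
qed

context
  fixes n :: nat and g h :: "complex mat"
  assumes g: "g \<in> carrier_mat n n" and h: "h \<in> carrier_mat n n"
    and gh: "g * h = 1\<^sub>m n" and hg: "h * g = 1\<^sub>m n"
begin

lemma act_inverse: "p \<in> polys n \<Longrightarrow> act g (act h p) = p" "p \<in> polys n \<Longrightarrow> act h (act g p) = p"
  using act_comp[OF g h, of p] act_comp[OF h g, of p] by (simp_all add: gh hg act_id)

text \<open>
  The chain rule. Conjugating \<open>\<partial>\<^sub>i\<close> with an algebra automorphism gives again a derivation, and it
  sends each variable to a constant, so it is a combination of the partial derivatives.
\<close>

lemma conj_pd: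
  assumes "i < n" "p \<in> polys n"
  shows "act g (pd i (act h p)) = (\<Sum>j<n. smul (h $$ (i, j)) (pd j p))"
  using assms(2)
proof (rule lin_eq_on_polys[rotated -1])
  show "lin (\<lambda>p. act g (pd i (act h p)))"
    by (intro lin_comp[OF lin_act] lin_comp[OF lin_pd] lin_act)
  show "lin (\<lambda>p. \<Sum>j<n. smul (h $$ (i, j)) (pd j p))"
    by (intro lin_lsum lin_comp[OF lin_scale] lin_pd)
  show "act g (pd i (act h 1)) = (\<Sum>j<n. smul (h $$ (i, j)) (pd j 1))"
    by (simp add: act_1 pd_1 lin_0[OF lin_act])
  fix k q assume k: "k < n" and q: "q \<in> polys n"
    and IH: "act g (pd i (act h q)) = (\<Sum>j<n. smul (h $$ (i, j)) (pd j q))"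
  have "act g (pd i (act h (X k * q)))
      = smul (h $$ (i, k)) (act g (act h q)) + act g (act h (X k)) * act g (pd i (act h q))"
    by (simp add: act_mult act_X pd_lform_mult[OF h \<open>i < n\<close>] lin_add[OF lin_act] lin_smul[OF lin_act])
  also have "\<dots> = smul (h $$ (i, k)) q + X k * (\<Sum>j<n. smul (h $$ (i, j)) (pd j q))"
    using q k by (simp add: act_inverse X_polys IH)
  also have "\<dots> = (\<Sum>j<n. smul (h $$ (i, j)) (pd j (X k * q)))"
    using k by (simp add: pd_X_mult cpoly.scale_right_distrib sum.distrib if_distrib[of "smul _"]
        smul_mult_right sum_distrib_left cong: if_cong)
  finally show "act g (pd i (act h (X k * q))) = (\<Sum>j<n. smul (h $$ (i, j)) (pd j (X k * q)))" .
qed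

lemma conj_var: "i < n \<Longrightarrow> p \<in> polys n \<Longrightarrow> act g (X i * act h p) = lform g i * p"
  by (simp add: act_mult act_X act_inverse)

text \<open>
  Conjugation by \<open>g\<close> maps the generators of the Weyl algebra to elements of the same degree, so it
  preserves the graded pieces. The conjugate is matched only on \<open>polys n\<close>, since \<open>act g\<close> is
  invertible there and in general not on polynomials in further variables.
\<close>

lemma weyl_homog_conj:
  "weyl_homog n k P \<Longrightarrow> \<exists>P'. weyl_homog n k P' \<and> (\<forall>p\<in>polys n. P' p = act g (P (act h p)))"
proof (induction rule: weyl_homog.induct)
  case (zero k)
  show ?case by (rule exI[of _ "\<lambda>b. 0"]) (simp add: weyl_homog.zero lin_0[OF lin_act])
next
  case (scalar c)
  show ?case
    by (rule exI[of _ "smul c"]) (simp add: weyl_homog.scalar lin_smul[OF lin_act] act_inverse)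
next
  case (var i)
  show ?case
    by (rule exI[of _ "\<lambda>b. lform g i * b"]) (use var weyl_homog_mult[OF lform_hom[OF g]] in \<open>simp add: conj_var\<close>)
next
  case (partial i)
  show ?case
    by (rule exI[of _ "\<lambda>b. \<Sum>j<n. smul (h $$ (i, j)) (pd j b)"])
      (auto simp: conj_pd partial intro!: weyl_homog_sum weyl_homog_smul weyl_homog.partial)
next
  case (add k P Q)
  then obtain P' Q' where "weyl_homog n k P'" "\<forall>p\<in>polys n. P' p = act g (P (act h p))"
    "weyl_homog n k Q'" "\<forall>p\<in>polys n. Q' p = act g (Q (act h p))" by blast
  then show ?case
    by (intro exI[of _ "\<lambda>b. P' b + Q' b"]) (simp add: weyl_homog.add lin_add[OF lin_act])
next
  case (comp k P l Q)
  then obtain P' Q' where "weyl_homog n k P'" "\<forall>p\<in>polys n. P' p = act g (P (act h p))"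
    "weyl_homog n l Q'" "\<forall>p\<in>polys n. Q' p = act g (Q (act h p))" by blast
  moreover have "Q (act h p) \<in> polys n" if "p \<in> polys n" for p
    using weyl_polys[OF weyl_homog_imp_weyl[OF comp(2)]] act_polys[OF h that] by blast
  ultimately show ?case
    by (intro exI[of _ "\<lambda>b. P' (Q' b)"]) (simp add: weyl_homog.comp act_inverse act_polys[OF g])
qed

lemma weyl_conj:
  "P \<in> weyl n \<Longrightarrow> \<exists>P'\<in>weyl n. \<forall>p\<in>polys n. P' p = act g (P (act h p))"
proof (induction rule: weyl.induct)
  case (scalar c)
  show ?case using weyl_homog_conj[OF weyl_homog.scalar] weyl_homog_imp_weyl by blast
next
  case (var i)
  show ?case using weyl_homog_conj[OF weyl_homog.var[OF var]] weyl_homog_imp_weyl by blast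
next
  case (partial i)
  show ?case using weyl_homog_conj[OF weyl_homog.partial[OF partial]] weyl_homog_imp_weyl by blast
next
  case (add P Q)
  then obtain P' Q' where "P' \<in> weyl n" "\<forall>p\<in>polys n. P' p = act g (P (act h p))"
    "Q' \<in> weyl n" "\<forall>p\<in>polys n. Q' p = act g (Q (act h p))" by blast
  then show ?case
    by (intro bexI[of _ "\<lambda>b. P' b + Q' b"]) (simp_all add: weyl.add lin_add[OF lin_act])
next
  case (comp P Q)
  then obtain P' Q' where "P' \<in> weyl n" "\<forall>p\<in>polys n. P' p = act g (P (act h p))"
    "Q' \<in> weyl n" "\<forall>p\<in>polys n. Q' p = act g (Q (act h p))" by blast
  moreover have "Q (act h p) \<in> polys n" if "p \<in> polys n" for p
    using weyl_polys[OF comp(2)] act_polys[OF h that] by blast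
  ultimately show ?case
    by (intro bexI[of _ "\<lambda>b. P' (Q' b)"]) (simp_all add: weyl.comp act_inverse act_polys[OF g])
qed

end

section \<open>Density of the Weyl algebra\<close>

text \<open>
  The Euler operator acts on the polynomials of degree \<open>d\<close> as the scalar \<open>d\<close>.
\<close>

definition euler :: "nat \<Rightarrow> cpoly \<Rightarrow> cpoly" where
  "euler n b = (\<Sum>i<n. X i * pd i b)"

lemma euler_homog: "weyl_homog n 0 (euler n)"
proof -
  have "weyl_homog n 0 (\<lambda>b. \<Sum>i<n. X i * pd i b)"
    using weyl_homog.comp[OF weyl_homog.var weyl_homog.partial, of _ n]
    by (intro weyl_homog_sum) auto
  then show ?thesis by (simp add: euler_def[abs_def])
qed

lemma euler_monomial:
  assumes "Poly_Mapping.keys m \<subseteq> {..<n}"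
  shows "euler n (monomial m) = smul (of_nat (mdeg m)) (monomial m)"
proof -
  have "X i * pd i (monomial m) = smul (of_nat (Poly_Mapping.lookup m i)) (monomial m)" for i
    using monomial_diff_add[of m i]
    by (cases "Poly_Mapping.lookup m i = 0") (simp_all add: pd_monomial smul_mult_right X_monomial flip: monomial_add)
  then show ?thesis
    using mdeg_superset[OF _ assms] by (simp add: euler_def cpoly.scale_sum_left)
qed

lemma weyl_homog_id: "weyl_homog n 0 (\<lambda>b. b)"
proof -
  have "smul 1 = (\<lambda>b. b)" by (rule ext) simp
  then show ?thesis using weyl_homog.scalar[of n 1] by simp
qed

text \<open>
  The product of the operators \<open>1 - E / s\<close> for \<open>s = 1, \<dots>, D\<close>, where \<open>E\<close> is the Euler
  operator: on a monomial of degree \<open>s\<close> between \<open>1\<close> and \<open>D\<close> the factor for \<open>s\<close> vanishes, and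
  every factor fixes the constants.
\<close>

lemma const_coeff_op:
  "\<exists>P. weyl_homog n 0 P \<and> (\<forall>m. Poly_Mapping.keys m \<subseteq> {..<n} \<longrightarrow> mdeg m \<le> D \<longrightarrow>
      P (monomial m) = (if m = 0 then 1 else 0))"
proof (induction D)
  case 0
  show ?case
    by (rule exI[of _ "\<lambda>b. b"]) (simp add: weyl_homog_id mdeg_eq_0 monomial_0)
next
  case (Suc D)
  then obtain P where P: "weyl_homog n 0 P"
    "\<And>m. Poly_Mapping.keys m \<subseteq> {..<n} \<Longrightarrow> mdeg m \<le> D \<Longrightarrow> P (monomial m) = (if m = 0 then 1 else 0)"
    by blast
  define Q where "Q = (\<lambda>b. P (b + smul (- 1 / of_nat (Suc D)) (euler n b)))"
  have "weyl_homog n (0 + 0) Q"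
    unfolding Q_def
    by (intro weyl_homog.comp[OF P(1)] weyl_homog.add weyl_homog_id weyl_homog_smul euler_homog)
  moreover have "Q (monomial m) = (if m = 0 then 1 else 0)"
    if m: "Poly_Mapping.keys m \<subseteq> {..<n}" "mdeg m \<le> Suc D" for m
  proof -
    have lin: "lin P" by (rule weyl_lin[OF weyl_homog_imp_weyl[OF P(1)]])
    have "Q (monomial m) = smul (1 - of_nat (mdeg m) / of_nat (Suc D)) (P (monomial m))"
      unfolding Q_def euler_monomial[OF m(1)] cpoly.scale_scale lin_add[OF lin] lin_smul[OF lin]
      by (simp add: cpoly.scale_left_diff_distrib del: of_nat_Suc)
    then show ?thesis
      using P(2)[OF m(1)] m(2) by (cases "mdeg m = Suc D") (auto simp: mdeg_eq_0 simp del: of_nat_Suc)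
  qed
  ultimately show ?case by auto
qed

text \<open>
  Up to degree \<open>D\<close>, the coefficient at \<open>m\<close> is the constant term of the iterated derivative along
  \<open>m\<close>, divided by the factorials. The factorials arise one factor at a time.
\<close>

lemma coeff_op:
  assumes "Poly_Mapping.keys m \<subseteq> {..<n}"
  shows "\<exists>P. weyl_homog n (- int (mdeg m)) P \<and>
    (\<forall>k. Poly_Mapping.keys k \<subseteq> {..<n} \<longrightarrow> mdeg k \<le> D \<longrightarrow> P (monomial k) = (if k = m then 1 else 0))"
  using assms
proof (induction rule: monomial_induct)
  case zero
  show ?case using const_coeff_op[of n D] by simp
next
  case (add i m)
  let ?e = "Poly_Mapping.single i (1::nat)"
  from add obtain P where P: "weyl_homog n (- int (mdeg m)) P"
    "\<And>k. Poly_Mapping.keys k \<subseteq> {..<n} \<Longrightarrow> mdeg k \<le> D \<Longrightarrow> P (monomial k) = (if k = m then 1 else 0)"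
    by blast
  have lin: "lin P" by (rule weyl_lin[OF weyl_homog_imp_weyl[OF P(1)]])
  define c where "c = 1 / complex_of_nat (Suc (Poly_Mapping.lookup m i))"
  define Q where "Q = (\<lambda>b. smul c (P (pd i b)))"
  have "weyl_homog n (- int (mdeg m) + - 1) Q"
    unfolding Q_def by (intro weyl_homog_smul weyl_homog.comp[OF P(1)] weyl_homog.partial add)
  then have "weyl_homog n (- int (mdeg (?e + m))) Q"
    by (simp add: mdeg_add algebra_simps)
  moreover have "Q (monomial k) = (if k = ?e + m then 1 else 0)"
    if k: "Poly_Mapping.keys k \<subseteq> {..<n}" "mdeg k \<le> D" for k
  proof (cases "Poly_Mapping.lookup k i = 0")
    case True
    then have "k \<noteq> ?e + m" by (auto simp: lookup_add)
    then show ?thesis using True by (simp add: Q_def pd_monomial lin_0[OF lin])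
  next
    case False
    note k' = monomial_diff_add[OF False]
    have "Poly_Mapping.keys (k - ?e) \<subseteq> Poly_Mapping.keys k"
      by (auto simp: in_keys_iff lookup_minus)
    moreover have "mdeg (k - ?e) \<le> D"
      using arg_cong[OF k', of mdeg] k(2) by (simp add: mdeg_add)
    ultimately have "P (monomial (k - ?e)) = (if k - ?e = m then 1 else 0)"
      using k(1) by (intro P(2)) auto
    moreover have "k - ?e = m \<longleftrightarrow> k = ?e + m"
      using k' by auto
    ultimately have "Q (monomial k) = smul (c * of_nat (Poly_Mapping.lookup k i)) (if k = ?e + m then 1 else 0)"
      by (simp add: Q_def pd_monomial lin_smul[OF lin])
    then show ?thesis
      by (auto simp: c_def lookup_add simp del: of_nat_Suc)
  qed
  ultimately show ?case by blast
qed

text \<open>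
  A linear map \<open>\<phi>\<close> is the sum over all monomials \<open>m\<close> of \<open>\<phi>(m)\<close> times the coefficient at \<open>m\<close>, and
  both factors are operators of the Weyl algebra.
\<close>

lemma density_aux:
  assumes "lin \<phi>"
  shows "\<exists>L. (\<forall>m. Poly_Mapping.keys m \<subseteq> {..<n} \<longrightarrow> weyl_homog n (- int (mdeg m)) (L m)) \<and>
    (\<forall>b\<in>bdd_polys n D. (\<Sum>m\<in>{m. Poly_Mapping.keys m \<subseteq> {..<n} \<and> mdeg m \<le> D}. \<phi> (monomial m) * L m b) = \<phi> b)"
proof -
  let ?M = "{m. Poly_Mapping.keys m \<subseteq> {..<n} \<and> mdeg m \<le> D}"
  have "\<forall>m. \<exists>P. Poly_Mapping.keys m \<subseteq> {..<n} \<longrightarrow> weyl_homog n (- int (mdeg m)) P \<and>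
      (\<forall>k. Poly_Mapping.keys k \<subseteq> {..<n} \<longrightarrow> mdeg k \<le> D \<longrightarrow> P (monomial k) = (if k = m then 1 else 0))"
    using coeff_op by blast
  then obtain L where L: "\<And>m. Poly_Mapping.keys m \<subseteq> {..<n} \<Longrightarrow> weyl_homog n (- int (mdeg m)) (L m)"
    "\<And>m k. Poly_Mapping.keys m \<subseteq> {..<n} \<Longrightarrow> Poly_Mapping.keys k \<subseteq> {..<n} \<Longrightarrow> mdeg k \<le> D \<Longrightarrow>
      L m (monomial k) = (if k = m then 1 else 0)"
    by (metis (no_types, lifting) choice)
  have "(\<Sum>m\<in>?M. \<phi> (monomial m) * L m b) = \<phi> b" if b: "b \<in> bdd_polys n D" for b
  proof (rule lin_eq_on_keys[of "\<lambda>b. \<Sum>m\<in>?M. \<phi> (monomial m) * L m b"])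
    show "lin (\<lambda>b. \<Sum>m\<in>?M. \<phi> (monomial m) * L m b)"
      using L(1) by (intro lin_lsum lin_comp[OF lin_times] weyl_lin[OF weyl_homog_imp_weyl]) auto
    fix k assume "k \<in> Poly_Mapping.keys b"
    then have k: "k \<in> ?M" using b by (auto simp: bdd_polys_def)
    have "(\<Sum>m\<in>?M. \<phi> (monomial m) * L m (monomial k)) = (\<Sum>m\<in>?M. if k = m then \<phi> (monomial m) else 0)"
      using k by (intro sum.cong) (auto simp: L(2))
    also have "\<dots> = \<phi> (monomial k)"
      using k by (simp add: finite_monomials)
    finally show "(\<Sum>m\<in>?M. \<phi> (monomial m) * L m (monomial k)) = \<phi> (monomial k)" .
  qed fact
  with L(1) show ?thesis by blast
qed

text \<open>
  Density: on polynomials of bounded degree, every linear endomorphism of \<open>B\<close> is a differential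
  operator. All equivariant maps constructed below become operators through this lemma or its graded
  form.
\<close>

lemma density:
  assumes "lin \<phi>" "\<And>b. b \<in> polys n \<Longrightarrow> \<phi> b \<in> polys n"
  shows "\<exists>P\<in>weyl n. \<forall>b\<in>bdd_polys n D. P b = \<phi> b"
proof -
  obtain L where L: "\<And>m. Poly_Mapping.keys m \<subseteq> {..<n} \<Longrightarrow> weyl_homog n (- int (mdeg m)) (L m)"
    "\<forall>b\<in>bdd_polys n D. (\<Sum>m\<in>{m. Poly_Mapping.keys m \<subseteq> {..<n} \<and> mdeg m \<le> D}. \<phi> (monomial m) * L m b) = \<phi> b"
    using density_aux[OF assms(1), of n D] by blast
  have "\<phi> (monomial m) \<in> polys n" if "Poly_Mapping.keys m \<subseteq> {..<n}" for m
    using that assms(2)[of "monomial m"] by (simp add: polys_def)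
  then have "(\<lambda>b. \<phi> (monomial m) * L m b) \<in> weyl n" if "Poly_Mapping.keys m \<subseteq> {..<n}" for m
    using that by (intro weyl.comp[OF weyl_mult] weyl_homog_imp_weyl[OF L(1)])
  then show ?thesis
    using L(2) by (intro bexI[OF _ weyl_sum[OF finite_monomials]]) auto
qed

lemma density_homog:
  assumes "lin \<phi>" "\<And>d b. b \<in> hom_polys n d \<Longrightarrow> \<phi> b \<in> homz n (int d + k)"
  shows "\<exists>P. weyl_homog n k P \<and> (\<forall>b\<in>bdd_polys n D. P b = \<phi> b)"
proof -
  obtain L where L: "\<And>m. Poly_Mapping.keys m \<subseteq> {..<n} \<Longrightarrow> weyl_homog n (- int (mdeg m)) (L m)"
    "\<forall>b\<in>bdd_polys n D. (\<Sum>m\<in>{m. Poly_Mapping.keys m \<subseteq> {..<n} \<and> mdeg m \<le> D}. \<phi> (monomial m) * L m b) = \<phi> b"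
    using density_aux[OF assms(1), of n D] by blast
  \<comment> \<open>If the target degree is negative, the summand is zero; otherwise its degree is \<open>(mdeg m + k) - mdeg m\<close>.\<close>
  have 1: "weyl_homog n k (\<lambda>b. \<phi> (monomial m) * L m b)" if m: "Poly_Mapping.keys m \<subseteq> {..<n}" for m
  proof (cases "int (mdeg m) + k < 0")
    case True
    then have "\<phi> (monomial m) = 0"
      using assms(2)[of "monomial m" "mdeg m"] m by (simp add: hom_polys_eq homz_def)
    then show ?thesis by (simp add: weyl_homog.zero)
  next
    case False
    then have "\<phi> (monomial m) \<in> hom_polys n (nat (int (mdeg m) + k))"
      using assms(2)[of "monomial m" "mdeg m"] m by (simp add: hom_polys_eq homz_def)
    from weyl_homog.comp[OF weyl_homog_mult[OF this] L(1)[OF m]] False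
    show ?thesis by simp
  qed
  let ?P = "\<lambda>b. \<Sum>m\<in>{m. Poly_Mapping.keys m \<subseteq> {..<n} \<and> mdeg m \<le> D}. \<phi> (monomial m) * L m b"
  have "weyl_homog n k ?P"
    by (rule weyl_homog_sum[OF finite_monomials]) (use 1 in auto)
  then show ?thesis
    using L(2) by blast
qed

section \<open>Finite linear groups and averaging\<close>

lemma group_GL: "group (GL n)"
proof -
  interpret ring "ring_mat TYPE(complex) n ()" by (rule ring_mat)
  show ?thesis unfolding GL_def by (rule units_group)
qed

lemma GL_simps: "x \<otimes>\<^bsub>GL n\<^esub> y = x * y" "\<one>\<^bsub>GL n\<^esub> = 1\<^sub>m n"
  by (simp_all add: GL_def units_of_mult units_of_one ring_mat_simps)

lemma GL_carrier: "carrier (GL n) \<subseteq> carrier_mat n n"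
  by (auto simp: GL_def units_of_carrier Units_def ring_mat_simps)

definition stable :: "complex mat set \<Rightarrow> cpoly set \<Rightarrow> bool" where
  "stable K U \<longleftrightarrow> (\<forall>g\<in>K. \<forall>u\<in>U. act g u \<in> U)"

definition gspan :: "complex mat set \<Rightarrow> cpoly set \<Rightarrow> cpoly set" where
  "gspan K S = cpoly.span {act g b | g b. g \<in> K \<and> b \<in> S}"

lemma subspace_gspan: "cpoly.subspace (gspan K S)"
  by (simp add: gspan_def)

lemma gspan_least:
  assumes "cpoly.subspace U" "stable K U" "S \<subseteq> U"
  shows "gspan K S \<subseteq> U"
  unfolding gspan_def using assms by (intro cpoly.span_minimal) (auto simp: stable_def)

lemma gspan_mono: "S \<subseteq> T \<Longrightarrow> gspan K S \<subseteq> gspan K T"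
  unfolding gspan_def by (intro cpoly.span_mono) auto

lemma act_in_gspan: "g \<in> K \<Longrightarrow> b \<in> S \<Longrightarrow> act g b \<in> gspan K S"
  unfolding gspan_def by (intro cpoly.span_base) auto

locale finite_linear_group =
  fixes n :: nat and K :: "complex mat set"
  assumes sub: "subgroup K (GL n)" and fin: "finite K"
begin

abbreviation ginv :: "complex mat \<Rightarrow> complex mat" where
  "ginv g \<equiv> inv\<^bsub>GL n\<^esub> g"

lemma K_mat: "g \<in> K \<Longrightarrow> g \<in> carrier_mat n n"
  using subgroup.subset[OF sub] GL_carrier by blast

lemma K_one: "1\<^sub>m n \<in> K"
  using subgroup.one_closed[OF sub] by (simp add: GL_simps)

lemma K_mult: "g \<in> K \<Longrightarrow> h \<in> K \<Longrightarrow> g * h \<in> K"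
  using subgroup.m_closed[OF sub, of g h] by (simp add: GL_simps)

lemma K_inv: "g \<in> K \<Longrightarrow> ginv g \<in> K"
  using subgroup.m_inv_closed[OF sub] by simp

lemma K_inverse: "g \<in> K \<Longrightarrow> g * ginv g = 1\<^sub>m n" "g \<in> K \<Longrightarrow> ginv g * g = 1\<^sub>m n"
  using group.r_inv[OF group_GL, of g n] group.l_inv[OF group_GL, of g n] subgroup.subset[OF sub]
  by (auto simp: GL_simps)

lemma ginv_mult: "g \<in> K \<Longrightarrow> h \<in> K \<Longrightarrow> ginv (g * h) = ginv h * ginv g"
  using group.inv_mult_group[OF group_GL, of g n h] subgroup.subset[OF sub]
  by (auto simp: GL_simps)

lemma card_K: "complex_of_nat (card K) \<noteq> 0"
  using fin K_one by auto

lemma act_act: "g \<in> K \<Longrightarrow> h \<in> K \<Longrightarrow> p \<in> polys n \<Longrightarrow> act g (act h p) = act (g * h) p"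
  by (rule act_comp[symmetric]) (simp_all add: K_mat)

lemma act_ginv: "g \<in> K \<Longrightarrow> p \<in> polys n \<Longrightarrow> act g (act (ginv g) p) = p"
  "g \<in> K \<Longrightarrow> p \<in> polys n \<Longrightarrow> act (ginv g) (act g p) = p"
  by (simp_all add: act_act K_inv K_inverse act_id)

lemma K_polys: "g \<in> K \<Longrightarrow> p \<in> polys n \<Longrightarrow> act g p \<in> polys n"
  by (rule act_polys[OF K_mat])

lemma stable_hom: "stable K (hom_polys n d)"
  by (auto simp: stable_def act_hom[OF K_mat])

lemma stable_bdd: "stable K (bdd_polys n d)"
  by (auto simp: stable_def act_bdd[OF K_mat])

lemma stable_polys: "stable K (polys n)"
  by (auto simp: stable_def K_polys)

lemma weyl_invI:
  "P \<in> weyl n \<Longrightarrow> (\<And>g b. g \<in> K \<Longrightarrow> b \<in> polys n \<Longrightarrow> act g (P b) = P (act g b)) \<Longrightarrow> P \<in> weyl_inv n K"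
  by (auto simp: weyl_inv_def K_inv K_polys act_ginv)

lemma inv_weyl: "P \<in> weyl_inv n K \<Longrightarrow> P \<in> weyl n"
  by (simp add: weyl_inv_def)

lemma inv_lin: "P \<in> weyl_inv n K \<Longrightarrow> lin P"
  by (rule weyl_lin[OF inv_weyl])

lemma inv_polys: "P \<in> weyl_inv n K \<Longrightarrow> p \<in> polys n \<Longrightarrow> P p \<in> polys n"
  by (rule weyl_polys[OF inv_weyl])

lemma inv_act:
  assumes "P \<in> weyl_inv n K" "g \<in> K" "b \<in> polys n"
  shows "act g (P b) = P (act g b)"
proof -
  have "act g (P (act (ginv g) (act g b))) = P (act g b)"
    using assms K_polys by (simp add: weyl_inv_def)
  then show ?thesis using assms by (simp add: act_ginv)
qed

lemma inv_smul: "smul c \<in> weyl_inv n K"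
  by (rule weyl_invI[OF weyl.scalar]) (simp add: lin_smul[OF lin_act])

lemma inv_add: "P \<in> weyl_inv n K \<Longrightarrow> Q \<in> weyl_inv n K \<Longrightarrow> (\<lambda>b. P b + Q b) \<in> weyl_inv n K"
  by (rule weyl_invI) (simp_all add: weyl.add inv_weyl lin_add[OF lin_act] inv_act)

lemma inv_comp: "P \<in> weyl_inv n K \<Longrightarrow> Q \<in> weyl_inv n K \<Longrightarrow> (\<lambda>b. P (Q b)) \<in> weyl_inv n K"
  by (rule weyl_invI) (simp_all add: weyl.comp inv_weyl inv_act inv_polys)

text \<open>
  Multiplication by \<open>h\<close> from the left permutes \<open>K\<close>, so a sum of conjugates over \<open>K\<close> is invariant.
  The operators \<open>Pg g\<close> are elements of the Weyl algebra that represent the conjugates on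
  \<open>polys n\<close>.
\<close>

lemma average_inv:
  assumes Pg: "\<And>g. g \<in> K \<Longrightarrow> Pg g \<in> weyl n"
    and eq: "\<And>g b. g \<in> K \<Longrightarrow> b \<in> polys n \<Longrightarrow> Pg g b = act g (P (act (ginv g) b))"
    and P: "\<And>b. b \<in> polys n \<Longrightarrow> P b \<in> polys n"
  shows "(\<lambda>b. smul c (\<Sum>g\<in>K. Pg g b)) \<in> weyl_inv n K"
proof (rule weyl_invI)
  show "(\<lambda>b. smul c (\<Sum>g\<in>K. Pg g b)) \<in> weyl n"
    by (intro weyl.comp[OF weyl.scalar] weyl_sum fin Pg)
  fix h b assume h: "h \<in> K" and b: "b \<in> polys n"
  \<comment> \<open>Conjugating by \<open>h\<close> turns the conjugate by \<open>g\<close> into the conjugate by \<open>h g\<close>.\<close>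
  have bij: "bij_betw (\<lambda>g. h * g) K K"
  proof (rule bij_betw_byWitness[where f' = "\<lambda>g. ginv h * g"])
    have hm: "h \<in> carrier_mat n n" "ginv h \<in> carrier_mat n n"
      using h by (auto intro: K_mat K_inv)
    show "\<forall>g\<in>K. ginv h * (h * g) = g"
      using assoc_mult_mat[OF hm(2,1) K_mat] by (simp add: K_inverse h left_mult_one_mat[OF K_mat])
    show "\<forall>g\<in>K. h * (ginv h * g) = g"
      using assoc_mult_mat[OF hm K_mat] by (simp add: K_inverse h left_mult_one_mat[OF K_mat])
  qed (use h K_mult K_inv in auto)
  have "act h (Pg g b) = Pg (h * g) (act h b)" if g: "g \<in> K" for g
  proof -
    have "Pg (h * g) (act h b) = act (h * g) (P (act (ginv g * ginv h) (act h b)))"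
      using h g b by (simp add: eq K_mult K_polys ginv_mult)
    also have "act (ginv g * ginv h) (act h b) = act (ginv g) b"
      using h g b by (simp add: act_act[symmetric] K_inv K_polys act_ginv)
    also have "act (h * g) (P (act (ginv g) b)) = act h (act g (P (act (ginv g) b)))"
      using h g b by (simp add: act_act K_inv K_polys P)
    finally show ?thesis using g b by (simp add: eq)
  qed
  then have "(\<Sum>g\<in>K. act h (Pg g b)) = (\<Sum>g\<in>K. Pg (h * g) (act h b))"
    by simp
  also have "\<dots> = (\<Sum>g\<in>K. Pg g (act h b))"
    by (rule sum.reindex_bij_betw[OF bij])
  finally show "act h (smul c (\<Sum>g\<in>K. Pg g b)) = smul c (\<Sum>g\<in>K. Pg g (act h b))"
    by (simp add: lin_smul[OF lin_act] lin_sum[OF lin_act])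
qed

definition avg :: "(cpoly \<Rightarrow> cpoly) \<Rightarrow> cpoly \<Rightarrow> cpoly" where
  "avg \<phi> b = smul (1 / of_nat (card K)) (\<Sum>g\<in>K. act g (\<phi> (act (ginv g) b)))"

text \<open>
  The Reynolds operator applied to density: up to a given degree, the invariant differential
  operators realise the average of every linear map.
\<close>

lemma averaged_density:
  assumes "lin \<phi>" "\<And>b. b \<in> polys n \<Longrightarrow> \<phi> b \<in> polys n"
  shows "\<exists>P\<in>weyl_inv n K. \<forall>b\<in>bdd_polys n D. P b = avg \<phi> b"
proof -
  obtain P where P: "P \<in> weyl n" "\<forall>b\<in>bdd_polys n D. P b = \<phi> b"
    using density[OF assms, where D = D] by blast
  have "\<forall>g\<in>K. \<exists>P'. P' \<in> weyl n \<and> (\<forall>b\<in>polys n. P' b = act g (P (act (ginv g) b)))"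
    using weyl_conj[OF K_mat K_mat[OF K_inv] K_inverse P(1)] by blast
  then obtain Pg where Pg: "\<forall>g\<in>K. Pg g \<in> weyl n \<and> (\<forall>b\<in>polys n. Pg g b = act g (P (act (ginv g) b)))"
    by (rule bchoice[THEN exE])
  let ?c = "1 / of_nat (card K) :: complex"
  have "(\<lambda>b. smul ?c (\<Sum>g\<in>K. Pg g b)) \<in> weyl_inv n K"
    by (rule average_inv[where P = P]) (use Pg weyl_polys[OF P(1)] in auto)
  moreover have "smul ?c (\<Sum>g\<in>K. Pg g b) = avg \<phi> b" if "b \<in> bdd_polys n D" for b
    unfolding avg_def
  proof (intro arg_cong[of _ _ "smul ?c"] sum.cong refl)
    fix g assume "g \<in> K"
    then show "Pg g b = act g (\<phi> (act (ginv g) b))"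
      using that Pg P(2) bdd_subset_polys[of n D] act_bdd[OF K_mat[OF K_inv]] by auto
  qed
  ultimately show ?thesis by (intro bexI[of _ "\<lambda>b. smul ?c (\<Sum>g\<in>K. Pg g b)"]) auto
qed

lemma averaged_density_homog:
  assumes "lin \<phi>" "\<And>d b. b \<in> hom_polys n d \<Longrightarrow> \<phi> b \<in> homz n (int d + k)"
  shows "\<exists>P\<in>weyl_inv n K. weyl_homog n k P \<and> (\<forall>b\<in>bdd_polys n D. P b = avg \<phi> b)"
proof -
  obtain P where P: "weyl_homog n k P" "\<forall>b\<in>bdd_polys n D. P b = \<phi> b"
    using density_homog[OF assms, where D = D] by blast
  have "\<forall>g\<in>K. \<exists>P'. weyl_homog n k P' \<and> (\<forall>b\<in>polys n. P' b = act g (P (act (ginv g) b)))"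
    using weyl_homog_conj[OF K_mat K_mat[OF K_inv] K_inverse P(1)] by blast
  then obtain Pg where Pg: "\<forall>g\<in>K. weyl_homog n k (Pg g) \<and> (\<forall>b\<in>polys n. Pg g b = act g (P (act (ginv g) b)))"
    by (rule bchoice[THEN exE])
  let ?c = "1 / of_nat (card K) :: complex"
  have "(\<lambda>b. smul ?c (\<Sum>g\<in>K. Pg g b)) \<in> weyl_inv n K"
    by (rule average_inv[where P = P])
      (use Pg weyl_polys[OF weyl_homog_imp_weyl[OF P(1)]] weyl_homog_imp_weyl in auto)
  moreover have "weyl_homog n k (\<lambda>b. smul ?c (\<Sum>g\<in>K. Pg g b))"
    using Pg by (intro weyl_homog_smul weyl_homog_sum fin) auto
  moreover have "smul ?c (\<Sum>g\<in>K. Pg g b) = avg \<phi> b" if "b \<in> bdd_polys n D" for b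
    unfolding avg_def
  proof (intro arg_cong[of _ _ "smul ?c"] sum.cong refl)
    fix g assume "g \<in> K"
    then show "Pg g b = act g (\<phi> (act (ginv g) b))"
      using that Pg P(2) bdd_subset_polys[of n D] act_bdd[OF K_mat[OF K_inv]] by auto
  qed
  ultimately show ?thesis by (intro bexI[of _ "\<lambda>b. smul ?c (\<Sum>g\<in>K. Pg g b)"]) auto
qed

lemma avg_equivariant:
  assumes "b \<in> polys n" "\<phi> b \<in> polys n" "\<And>g. g \<in> K \<Longrightarrow> \<phi> (act g b) = act g (\<phi> b)"
  shows "avg \<phi> b = \<phi> b"
proof -
  have "(\<Sum>g\<in>K. act g (\<phi> (act (ginv g) b))) = (\<Sum>g\<in>K. \<phi> b)"
    using assms by (intro sum.cong) (simp_all add: K_inv act_ginv)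
  also have "\<dots> = smul (of_nat (card K)) (\<phi> b)"
    by (rule cpoly.sum_constant_scale)
  finally show ?thesis
    using card_K by (simp add: avg_def)
qed

lemma avg_in:
  assumes "cpoly.subspace S" "stable K S" "range \<phi> \<subseteq> S"
  shows "avg \<phi> b \<in> S"
  unfolding avg_def using assms
  by (intro cpoly.subspace_scale cpoly.subspace_sum) (auto simp: stable_def subset_eq)

lemma projection_exists:
  assumes "cpoly.subspace S"
  shows "\<exists>\<pi>. lin \<pi> \<and> range \<pi> \<subseteq> S \<and> (\<forall>s\<in>S. \<pi> s = s)"
  using cpoly_pair.linear_exists_left_inverse_on[OF lin_id assms] by auto

text \<open>
  Maschke's theorem inside the ring of invariant operators: the average of a linear projection onto
  a stable subspace is an equivariant projection.
\<close>

lemma projection_op: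
  assumes "cpoly.subspace S" "stable K S" "S \<subseteq> bdd_polys n D"
  shows "\<exists>P\<in>weyl_inv n K. (\<forall>s\<in>S. P s = s) \<and> (\<forall>b\<in>bdd_polys n D. P b \<in> S)"
proof -
  obtain \<pi> where \<pi>: "lin \<pi>" "range \<pi> \<subseteq> S" "\<forall>s\<in>S. \<pi> s = s"
    using projection_exists[OF assms(1)] by blast
  have pol: "S \<subseteq> polys n" using assms(3) bdd_subset_polys by blast
  obtain P where P: "P \<in> weyl_inv n K" "\<forall>b\<in>bdd_polys n D. P b = avg \<pi> b"
    using averaged_density[OF \<pi>(1), where D = D] \<pi>(2) pol by blast
  have "avg \<pi> s = s" if "s \<in> S" for s
    using avg_equivariant[of s \<pi>] that \<pi> pol assms(2) by (auto simp: stable_def)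
  then have "\<forall>s\<in>S. P s = s" using P(2) assms(3) by auto
  moreover have "\<forall>b\<in>bdd_polys n D. P b \<in> S"
    using P(2) avg_in[OF assms(1,2) \<pi>(2)] by auto
  ultimately show ?thesis using P(1) by blast
qed

lemma projection_op_homog:
  assumes "cpoly.subspace S" "stable K S" "S \<subseteq> hom_polys n d"
  shows "\<exists>P\<in>deg0_part n (weyl_inv n K). (\<forall>s\<in>S. P s = s) \<and> (\<forall>b\<in>hom_polys n d. P b \<in> S)"
proof -
  obtain \<pi> where \<pi>: "lin \<pi>" "range \<pi> \<subseteq> S" "\<forall>s\<in>S. \<pi> s = s"
    using projection_exists[OF assms(1)] by blast
  \<comment> \<open>Composing with the component of degree \<open>d\<close> makes the projection homogeneous of degree zero.\<close>
  define \<phi> where "\<phi> = (\<lambda>b. \<pi> (hcomp d b))"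
  have pol: "S \<subseteq> polys n" using assms(3) hom_subset_polys by blast
  have \<phi>: "lin \<phi>" "range \<phi> \<subseteq> S" "\<forall>s\<in>S. \<phi> s = s"
    using \<pi> assms(3) by (auto simp: \<phi>_def hcomp_id intro: lin_comp lin_hcomp)
  have "\<phi> b \<in> homz n (int e + 0)" if "b \<in> hom_polys n e" for b e
  proof (cases "e = d")
    case True
    then show ?thesis using \<phi>(2) assms(3) by auto
  next
    case False
    then show ?thesis using that
      by (simp add: \<phi>_def hcomp_other lin_0[OF \<pi>(1)] cpoly.subspace_0[OF subspace_hom])
  qed
  from averaged_density_homog[OF \<phi>(1) this, where D = d]
  obtain P where P: "P \<in> weyl_inv n K" "weyl_homog n 0 P" "\<forall>b\<in>bdd_polys n d. P b = avg \<phi> b"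
    by blast
  have "avg \<phi> s = s" if "s \<in> S" for s
    using avg_equivariant[of s \<phi>] that \<phi> pol assms(2) by (auto simp: stable_def)
  then have "\<forall>s\<in>S. P s = s" using P(3) assms(3) hom_subset_bdd[of d d n] by auto
  moreover have "\<forall>b\<in>hom_polys n d. P b \<in> S"
    using P(3) avg_in[OF assms(1,2) \<phi>(2)] hom_subset_bdd[of d d n] by auto
  ultimately show ?thesis using P(1,2) by (auto simp: deg0_part_def)
qed

text \<open>
  Every equivariant linear map on a piece of bounded degree comes from an invariant operator, as
  averaging does not change it.
\<close>

lemma extension_op:
  assumes "lin \<phi>" "\<And>b. b \<in> polys n \<Longrightarrow> \<phi> b \<in> polys n" "S \<subseteq> bdd_polys n D"
    and "\<And>g b. g \<in> K \<Longrightarrow> b \<in> S \<Longrightarrow> \<phi> (act g b) = act g (\<phi> b)"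
  shows "\<exists>P\<in>weyl_inv n K. \<forall>b\<in>S. P b = \<phi> b"
proof -
  obtain P where P: "P \<in> weyl_inv n K" "\<forall>b\<in>bdd_polys n D. P b = avg \<phi> b"
    using averaged_density[OF assms(1,2), where D = D] by blast
  have "P b = \<phi> b" if "b \<in> S" for b
  proof -
    have b: "b \<in> bdd_polys n D" "b \<in> polys n"
      using that assms(3) bdd_subset_polys[of n D] by auto
    have "avg \<phi> b = \<phi> b"
      by (rule avg_equivariant) (use b that assms(2,4) in auto)
    then show ?thesis using P(2) b by simp
  qed
  with P(1) show ?thesis by blast
qed

lemma hcomp_act:
  assumes "g \<in> K" "b \<in> polys n"
  shows "hcomp d (act g b) = act g (hcomp d b)"
proof (rule lin_eq_on_keys[OF lin_comp[OF lin_hcomp lin_act] lin_comp[OF lin_act lin_hcomp]])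
  fix m assume "m \<in> Poly_Mapping.keys b"
  then have "act g (monomial m) \<in> hom_polys n (mdeg m)"
    using assms by (intro act_monomial_hom[OF K_mat]) (auto simp: polys_def)
  then show "hcomp d (act g (monomial m)) = act g (hcomp d (monomial m))"
    by (cases "mdeg m = d") (auto simp: hcomp_monomial hcomp_id hcomp_other lin_0[OF lin_act])
qed

lemma hcomp_op:
  "\<exists>P\<in>weyl_inv n K. \<forall>b\<in>bdd_polys n D. P b = hcomp d b"
proof (rule extension_op[OF lin_hcomp _ order_refl])
  show "hcomp d b \<in> polys n" if "b \<in> polys n" for b
    using hcomp_hom[OF that] hom_subset_polys by blast
  show "hcomp d (act g b) = act g (hcomp d b)" if "g \<in> K" "b \<in> bdd_polys n D" for g b
    using that bdd_subset_polys by (intro hcomp_act) auto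
qed

text \<open>
  The graded pieces of an invariant operator are realised by invariant homogeneous operators, up to
  degree \<open>D\<close>. These supply the operators of negative degree.
\<close>

lemma op_component:
  assumes "P \<in> weyl_inv n K"
  shows "\<exists>Q\<in>weyl_inv n K. weyl_homog n (int e - int d) Q \<and>
    (\<forall>b\<in>bdd_polys n D. Q b = hcomp e (P (hcomp d b)))"
proof -
  define \<phi> where "\<phi> = (\<lambda>b. hcomp e (P (hcomp d b)))"
  have lin: "lin \<phi>" unfolding \<phi>_def by (intro lin_comp[OF lin_hcomp] lin_comp[OF inv_lin[OF assms]] lin_hcomp)
  have hp: "hcomp d b \<in> polys n" if "b \<in> polys n" for b d
    using hcomp_hom[OF that] hom_subset_polys by blast
  have "\<phi> b \<in> homz n (int c + (int e - int d))" if "b \<in> hom_polys n c" for b c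
  proof (cases "c = d")
    case True
    have "P (hcomp d b) \<in> polys n"
      using that hom_subset_polys by (intro inv_polys[OF assms] hp) blast
    from hcomp_hom[OF this] show ?thesis using True by (simp add: \<phi>_def)
  next
    case False
    then show ?thesis using that
      by (simp add: \<phi>_def hcomp_other lin_0[OF inv_lin[OF assms]] lin_0[OF lin_hcomp] cpoly.subspace_0[OF subspace_homz])
  qed
  from averaged_density_homog[OF lin this, where D = D]
  obtain Q where Q: "Q \<in> weyl_inv n K" "weyl_homog n (int e - int d) Q" "\<forall>b\<in>bdd_polys n D. Q b = avg \<phi> b"
    by blast
  have "avg \<phi> b = \<phi> b" if "b \<in> polys n" for b
    by (rule avg_equivariant)
      (simp_all add: that \<phi>_def hp inv_polys[OF assms] hcomp_act inv_act[OF assms, symmetric] K_polys)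
  then have "\<forall>b\<in>bdd_polys n D. Q b = \<phi> b" using Q(3) bdd_subset_polys[of n D] by auto
  then show ?thesis using Q(1,2) unfolding \<phi>_def by blast
qed

lemma gspan_superset: "S \<subseteq> polys n \<Longrightarrow> S \<subseteq> gspan K S"
  using act_in_gspan[OF K_one] act_id by fastforce

lemma stable_gspan:
  assumes "S \<subseteq> polys n" shows "stable K (gspan K S)"
  unfolding stable_def
proof clarify
  fix g u assume g: "g \<in> K" and u: "u \<in> gspan K S"
  have "gspan K S \<subseteq> {u. act g u \<in> gspan K S}"
    unfolding gspan_def[of _ S]
  proof (rule cpoly.span_minimal)
    show "cpoly.subspace {u. act g u \<in> cpoly.span {act g b |g b. g \<in> K \<and> b \<in> S}}"
      by (rule lin_subspace_vimage[OF lin_act cpoly.subspace_span])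
    show "{act g b |g b. g \<in> K \<and> b \<in> S} \<subseteq> {u. act g u \<in> cpoly.span {act g b |g b. g \<in> K \<and> b \<in> S}}"
    proof clarify
      fix h b assume "h \<in> K" "b \<in> S"
      then have "act g (act h b) = act (g * h) b" "g * h \<in> K"
        using assms g by (auto simp: act_act K_mult)
      then show "act g (act h b) \<in> cpoly.span {act g b |g b. g \<in> K \<and> b \<in> S}"
        using \<open>b \<in> S\<close> by (intro cpoly.span_base) auto
    qed
  qed
  with u show "act g u \<in> gspan K S" by blast
qed

lemma gspan_hom: "S \<subseteq> hom_polys n d \<Longrightarrow> gspan K S \<subseteq> hom_polys n d"
  by (rule gspan_least[OF subspace_hom stable_hom])

lemma gspan_bdd: "S \<subseteq> bdd_polys n d \<Longrightarrow> gspan K S \<subseteq> bdd_polys n d"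
  by (rule gspan_least[OF subspace_bdd stable_bdd])

lemma gspan_polys: "S \<subseteq> polys n \<Longrightarrow> gspan K S \<subseteq> polys n"
  by (rule gspan_least[OF subspace_polys stable_polys])

lemma stable_vimage:
  assumes "P \<in> weyl_inv n K" "stable K S"
  shows "stable K {b \<in> polys n. P b \<in> S}"
  using assms K_polys by (auto simp: stable_def inv_act[symmetric])

lemma op_gspan:
  assumes "P \<in> weyl_inv n K" "S \<subseteq> polys n" "T \<subseteq> polys n" "\<And>s. s \<in> S \<Longrightarrow> P s \<in> gspan K T"
    and "b \<in> gspan K S"
  shows "P b \<in> gspan K T"
proof -
  have "gspan K S \<subseteq> {b \<in> polys n. P b \<in> gspan K T}"
  proof (rule gspan_least)
    have "{b \<in> polys n. P b \<in> gspan K T} = polys n \<inter> {b. P b \<in> gspan K T}" by blast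
    then show "cpoly.subspace {b \<in> polys n. P b \<in> gspan K T}"
      by (simp add: cpoly.subspace_inter subspace_polys lin_subspace_vimage[OF inv_lin[OF assms(1)] subspace_gspan])
  qed (use assms stable_vimage[OF assms(1) stable_gspan] in auto)
  with assms(5) show ?thesis by blast
qed

end

section \<open>Eigenvectors\<close>

text \<open>
  The vectors \<open>v i\<close> may repeat. A repetition is itself a relation; without one the \<open>v i\<close> are too
  many to be independent.
\<close>

lemma linear_relation:
  assumes "finite T" "\<And>i. i \<le> card T \<Longrightarrow> v i \<in> cpoly.span T"
  shows "\<exists>f. (\<exists>i\<le>card T. f i \<noteq> 0) \<and> (\<Sum>i\<le>card T. smul (f i) (v i)) = 0"
proof (cases "inj_on v {..card T}")
  case True
  let ?S = "v ` {..card T}"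
  have "card ?S = Suc (card T)" using card_image[OF True] by simp
  moreover have "?S \<subseteq> cpoly.span T" using assms(2) by auto
  ultimately have "cpoly.dependent ?S"
    using cpoly.independent_span_bound[OF assms(1), of ?S] by auto
  then obtain u where u: "\<exists>w\<in>?S. u w \<noteq> 0" "(\<Sum>w\<in>?S. smul (u w) w) = 0"
    by (auto simp: cpoly.dependent_finite)
  have "(\<Sum>i\<le>card T. smul (u (v i)) (v i)) = 0"
    using u(2) by (simp add: sum.reindex[OF True])
  with u(1) show ?thesis by (intro exI[of _ "\<lambda>i. u (v i)"]) auto
next
  case False
  then obtain i j where ij: "i \<le> card T" "j \<le> card T" "v i = v j" "i \<noteq> j"
    by (auto simp: inj_on_def)
  let ?f = "\<lambda>k. (if k = i then 1 else 0) - (if k = j then 1 else (0::complex))"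
  have "(\<Sum>k\<le>card T. smul (?f k) (v k))
      = (\<Sum>k\<le>card T. if k = i then v k else 0) - (\<Sum>k\<le>card T. if k = j then v k else 0)"
    unfolding sum_subtractf[symmetric]
    by (intro sum.cong) (auto simp: cpoly.scale_left_diff_distrib)
  also have "\<dots> = 0" using ij by (simp add: sum.delta)
  finally show ?thesis using ij by (intro exI[of _ ?f]) auto
qed

text \<open>
  Let \<open>c\<close> be a root of \<open>p = (t - c) q\<close>. Either \<open>P - c\<close> kills \<open>x\<close>, or \<open>(P - c) x\<close> is a nonzero vector
  that \<open>q\<close> annihilates, and the degree has dropped.
\<close>

lemma eigenvector_of_annihilating_poly:
  fixes p :: "complex poly"
  assumes P: "lin P" and U: "cpoly.subspace U" "\<And>u. u \<in> U \<Longrightarrow> P u \<in> U"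
    and "x \<in> U" "x \<noteq> 0" "p \<noteq> 0" "degree p = k" "(\<Sum>i\<le>k. smul (coeff p i) ((P ^^ i) x)) = 0"
  shows "\<exists>c w. w \<in> U \<and> w \<noteq> 0 \<and> P w = smul c w"
  using assms(4-)
proof (induction k arbitrary: p x)
  case 0
  then have "coeff p 0 \<noteq> 0" by (metis leading_coeff_0_iff)
  with 0 show ?case by simp
next
  case (Suc k)
  then have "\<not> constant (poly p)" by (simp add: constant_degree)
  then obtain c where "poly p c = 0" using fundamental_theorem_of_algebra by blast
  then obtain q where q: "p = [:- c, 1:] * q" by (auto simp: poly_eq_0_iff_dvd)
  have "q \<noteq> 0" using q Suc.prems by auto
  then have "degree p = degree [:- c, 1:] + degree q"
    unfolding q by (intro degree_mult_eq) auto
  then have deg: "degree q = k"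
    using Suc.prems by simp
  define y where "y = P x - smul c x"
  show ?case
  proof (cases "y = 0")
    case True
    then show ?thesis using Suc.prems by (intro exI[of _ c] exI[of _ x]) (simp add: y_def)
  next
    case False
    have y: "y \<in> U" using Suc.prems U by (simp add: y_def cpoly.subspace_diff cpoly.subspace_scale)
    have lin: "lin (P ^^ i)" for i
      by (induction i) (simp_all add: id_def lin_id lin_comp[OF P] comp_def)
    have p: "p = pCons 0 q - smult c q" using q by simp
    have "(\<Sum>i\<le>k. smul (coeff q i) ((P ^^ i) y))
        = (\<Sum>i\<le>k. smul (coeff q i) ((P ^^ Suc i) x)) - (\<Sum>i\<le>k. smul (c * coeff q i) ((P ^^ i) x))"
      by (simp add: y_def lin_diff[OF lin] lin_smul[OF lin] cpoly.scale_right_diff_distrib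
          sum_subtractf mult.commute funpow_swap1)
    also have "(\<Sum>i\<le>k. smul (coeff q i) ((P ^^ Suc i) x)) = (\<Sum>i\<le>Suc k. smul (coeff (pCons 0 q) i) ((P ^^ i) x))"
      by (subst sum.atMost_Suc_shift) simp
    also have "(\<Sum>i\<le>k. smul (c * coeff q i) ((P ^^ i) x)) = (\<Sum>i\<le>Suc k. smul (c * coeff q i) ((P ^^ i) x))"
      using deg by (simp add: coeff_eq_0)
    also have "(\<Sum>i\<le>Suc k. smul (coeff (pCons 0 q) i) ((P ^^ i) x)) - \<dots>
        = (\<Sum>i\<le>Suc k. smul (coeff p i) ((P ^^ i) x))"
      unfolding sum_subtractf[symmetric] by (intro sum.cong) (simp_all add: p cpoly.scale_left_diff_distrib)
    finally have "(\<Sum>i\<le>k. smul (coeff q i) ((P ^^ i) y)) = 0" using Suc.prems by simp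
    from Suc.IH[OF y False \<open>q \<noteq> 0\<close> deg this] show ?thesis .
  qed
qed

lemma eigenvector_exists:
  assumes P: "lin P" and U: "cpoly.subspace U" "\<And>u. u \<in> U \<Longrightarrow> P u \<in> U"
    and fin: "finite T" "U \<subseteq> cpoly.span T" and x: "x \<in> U" "x \<noteq> 0"
  shows "\<exists>c w. w \<in> U \<and> w \<noteq> 0 \<and> P w = smul c w"
proof -
  have "(P ^^ i) x \<in> U" for i by (induction i) (use x U in auto)
  then obtain f where f: "\<exists>i\<le>card T. f i \<noteq> 0" "(\<Sum>i\<le>card T. smul (f i) ((P ^^ i) x)) = 0"
    using linear_relation[OF fin(1), of "\<lambda>i. (P ^^ i) x"] fin(2) by blast
  define p where "p = (\<Sum>i\<le>card T. monom (f i) i)"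
  have p: "coeff p i = (if i \<le> card T then f i else 0)" for i
    by (simp add: p_def coeff_sum)
  then have "p \<noteq> 0" using f(1) by (metis coeff_0)
  moreover have deg: "degree p \<le> card T" by (rule degree_le) (simp add: p)
  have "(\<Sum>i\<le>degree p. smul (coeff p i) ((P ^^ i) x)) = (\<Sum>i\<le>card T. smul (coeff p i) ((P ^^ i) x))"
    using deg by (intro sum.mono_neutral_left) (auto simp: coeff_eq_0)
  then have "(\<Sum>i\<le>degree p. smul (coeff p i) ((P ^^ i) x)) = 0"
    using f(2) by (simp add: p)
  ultimately show ?thesis
    using eigenvector_of_annihilating_poly[OF P U x] by blast
qed

section \<open>Simple modules and irreducible representations\<close>

text \<open>
  The values \<open>P c\<close> form a submodule that contains \<open>c\<close>.
\<close>

lemma simple_submod_cyclic: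
  assumes N: "simple_submod n D N"
    and smul: "\<And>c. smul c \<in> D"
    and add: "\<And>P Q. P \<in> D \<Longrightarrow> Q \<in> D \<Longrightarrow> (\<lambda>b. P b + Q b) \<in> D"
    and comp: "\<And>P Q. P \<in> D \<Longrightarrow> Q \<in> D \<Longrightarrow> (\<lambda>b. P (Q b)) \<in> D"
    and c: "c \<in> N" "c \<noteq> 0" and a: "a \<in> N"
  shows "\<exists>P\<in>D. P c = a"
proof -
  have sub: "submod n D N" using N by (simp add: simple_submod_def)
  let ?M = "{P c | P. P \<in> D}"
  have "cpoly.subspace ?M"
  proof (rule cpoly.subspaceI)
    show "0 \<in> ?M" using smul[of 0] by (auto intro!: exI[of _ "smul 0"])
    fix x y assume "x \<in> ?M" "y \<in> ?M"
    then show "x + y \<in> ?M" using add by fastforce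
  next
    fix k x assume "x \<in> ?M"
    then show "smul k x \<in> ?M" using comp[OF smul] by fastforce
  qed
  moreover have "?M \<subseteq> N" using sub c by (auto simp: submod_def)
  moreover have "P b \<in> ?M" if "P \<in> D" "b \<in> ?M" for P b using that comp by fastforce
  ultimately have "submod n D ?M" using sub by (auto simp: submod_def)
  moreover have "c \<in> ?M" using smul[of 1] by (auto intro!: exI[of _ "smul 1"])
  ultimately have "?M = N" using N c \<open>?M \<subseteq> N\<close> unfolding simple_submod_def by blast
  then show ?thesis using a by blast
qed

lemma mat_group_simps [simp]:
  "carrier (mat_group n K) = K" "x \<otimes>\<^bsub>mat_group n K\<^esub> y = x * y" "\<one>\<^bsub>mat_group n K\<^esub> = 1\<^sub>m n"
  by (simp_all add: mat_group_def GL_simps)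

lemma poly_rep_simps [simp]:
  "Space (poly_rep U) = U" "scal (poly_rep U) = smul" "gact (poly_rep U) = act"
  by (simp_all add: poly_rep_def)

lemma invariant_subspace_iff:
  "invariant_subspace (mat_group n K) (poly_rep U) V \<longleftrightarrow> cpoly.subspace V \<and> V \<subseteq> U \<and> stable K V"
  by (auto simp: invariant_subspace_def stable_def)

definition irred :: "complex mat set \<Rightarrow> cpoly set \<Rightarrow> bool" where
  "irred K U \<longleftrightarrow> cpoly.subspace U \<and> stable K U \<and> U \<noteq> {0} \<and>
     (\<forall>V. cpoly.subspace V \<longrightarrow> stable K V \<longrightarrow> V \<subseteq> U \<longrightarrow> V = {0} \<or> V = U)"

lemma irredD:
  "irred K U \<Longrightarrow> cpoly.subspace V \<Longrightarrow> stable K V \<Longrightarrow> V \<subseteq> U \<Longrightarrow> V = {0} \<or> V = U"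
  by (simp add: irred_def)

text \<open>
  The relation \<open>rep_iso\<close> has a direction, and the isomorphisms below are constructed in the opposite
  one, by operators that start at the orbit span of a single vector.
\<close>

lemma rep_iso_inverse:
  assumes F: "bij_betw F (Space R) (Space S)"
    and add: "\<And>u v. u \<in> Space R \<Longrightarrow> v \<in> Space R \<Longrightarrow> u + v \<in> Space R \<and> F (u + v) = F u + F v"
    and scal: "\<And>c u. u \<in> Space R \<Longrightarrow> scal R c u \<in> Space R \<and> F (scal R c u) = scal S c (F u)"
    and gact: "\<And>g u. g \<in> carrier K \<Longrightarrow> u \<in> Space R \<Longrightarrow> gact R g u \<in> Space R \<and> F (gact R g u) = gact S g (F u)"
  shows "rep_iso K S R"
proof -
  let ?f = "inv_into (Space R) F"
  have f: "?f u \<in> Space R" "F (?f u) = u" if "u \<in> Space S" for u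
    using that F by (auto simp: bij_betw_def inv_into_into f_inv_into_f)
  have fF: "?f (F u) = u" if "u \<in> Space R" for u
    using that F by (simp add: bij_betw_def)
  have "bij_betw ?f (Space S) (Space R)" by (rule bij_betw_inv_into[OF F])
  moreover have "?f (u + v) = ?f u + ?f v" if "u \<in> Space S" "v \<in> Space S" for u v
    using add[of "?f u" "?f v"] fF[of "?f u + ?f v"] f that by simp
  moreover have "?f (scal S c u) = scal R c (?f u)" if "u \<in> Space S" for c u
    using scal[of "?f u" c] fF[of "scal R c (?f u)"] f that by simp
  moreover have "?f (gact S g u) = gact R g (?f u)" if "g \<in> carrier K" "u \<in> Space S" for g u
    using gact[of g "?f u"] fF[of "gact R g (?f u)"] f that by simp
  ultimately show ?thesis unfolding rep_iso_def by blast
qed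

context finite_linear_group
begin

lemma representation_poly:
  assumes "cpoly.subspace U" "stable K U" "U \<subseteq> polys n"
  shows "representation (mat_group n K) (poly_rep U)"
  unfolding representation_def using assms cpoly.vector_space_axioms
  by (auto simp: stable_def lin_add[OF lin_act] lin_smul[OF lin_act] act_act act_id subset_eq)

lemma irreducible_iff:
  assumes "U \<subseteq> polys n"
  shows "irreducible_rep (mat_group n K) (poly_rep U) \<longleftrightarrow> irred K U"
proof
  assume L: "irreducible_rep (mat_group n K) (poly_rep U)"
  then have "cpoly.subspace U" "stable K U"
    by (auto simp: irreducible_rep_def representation_def stable_def)
  with L show "irred K U" by (auto simp: irreducible_rep_def irred_def invariant_subspace_iff)
qed (use representation_poly assms in \<open>auto simp: irreducible_rep_def irred_def invariant_subspace_iff\<close>)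

section \<open>Isotypic components and annihilated parts\<close>

lemma submod_hcomp:
  assumes "submod n (weyl_inv n K) N" "b \<in> N"
  shows "hcomp d b \<in> N"
proof -
  have "b \<in> polys n" using assms by (auto simp: submod_def)
  then obtain D where "b \<in> bdd_polys n D" using polys_bdd by blast
  then show ?thesis using hcomp_op[of D d] assms by (fastforce simp: submod_def)
qed

text \<open>
  The double centraliser argument in its smallest form: a map \<open>f\<close> that commutes with the invariant
  operators commutes with an equivariant projection \<open>P\<close> onto the span of the orbit of \<open>b\<close>. Since \<open>P\<close>
  fixes \<open>b\<close>, it fixes \<open>f b\<close>.
\<close>

lemma linear_in_orbit_span:
  assumes "submod n (weyl_inv n K) N" "b \<in> N" "f b \<in> polys n"
    and "\<And>P. P \<in> weyl_inv n K \<Longrightarrow> f (P b) = P (f b)"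
  shows "f b \<in> gspan K {b}"
proof -
  have "{b, f b} \<subseteq> polys n" using assms(1-3) by (auto simp: submod_def)
  then obtain D where D: "{b, f b} \<subseteq> bdd_polys n D" using finite_bdd[of "{b, f b}" n] by blast
  then obtain P where P: "P \<in> weyl_inv n K" "\<forall>s\<in>gspan K {b}. P s = s" "\<forall>x\<in>bdd_polys n D. P x \<in> gspan K {b}"
    using projection_op[OF subspace_gspan stable_gspan gspan_bdd, of "{b}" D] bdd_subset_polys[of n D] by auto
  have "b \<in> gspan K {b}" using gspan_superset[of "{b}"] assms(1,2) by (auto simp: submod_def)
  then have "f b = P (f b)" using assms(4)[OF P(1)] P(2) by simp
  also have "\<dots> \<in> gspan K {b}" using P(3) D by auto
  finally show ?thesis .
qed

lemma submod_act:
  assumes N: "submod n (weyl_inv n K) N" and g: "g \<in> K"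
  shows "submod n (weyl_inv n K) (act g ` N)"
  using N g lin_subspace_image[OF lin_act, of N g] K_polys
  by (fastforce simp: submod_def inv_act[symmetric])

lemma act_image_inverse:
  assumes "N \<subseteq> polys n" "g \<in> K"
  shows "act (ginv g) ` act g ` N = N" "act g ` act (ginv g) ` N = N"
proof -
  have "act (ginv g) (act g x) = x" "act g (act (ginv g) x) = x" if "x \<in> N" for x
    using that assms by (auto simp: act_ginv)
  then show "act (ginv g) ` act g ` N = N" "act g ` act (ginv g) ` N = N"
    by (simp_all add: image_image)
qed

lemma simple_submod_act:
  assumes N: "simple_submod n (weyl_inv n K) N" and g: "g \<in> K"
  shows "simple_submod n (weyl_inv n K) (act g ` N)"
  unfolding simple_submod_def
proof (intro conjI allI impI)
  have sub: "submod n (weyl_inv n K) N" "N \<noteq> {0}" "N \<subseteq> polys n"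
    using N by (auto simp: simple_submod_def submod_def)
  show "submod n (weyl_inv n K) (act g ` N)" by (rule submod_act[OF sub(1) g])
  show "act g ` N \<noteq> {0}"
    using act_image_inverse(1)[OF sub(3) g] sub(2) by (auto simp: lin_0[OF lin_act])
  fix M assume M: "submod n (weyl_inv n K) M \<and> M \<subseteq> act g ` N"
  then have pM: "M \<subseteq> polys n" by (simp add: submod_def)
  have "submod n (weyl_inv n K) (act (ginv g) ` M)" "act (ginv g) ` M \<subseteq> N"
    using M submod_act[OF _ K_inv[OF g]] act_image_inverse(1)[OF sub(3) g] by blast+
  then have "act (ginv g) ` M = {0} \<or> act (ginv g) ` M = N"
    using N by (simp add: simple_submod_def)
  then have "act g ` act (ginv g) ` M = {0} \<or> act g ` act (ginv g) ` M = act g ` N"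
    by (elim disjE) (simp_all add: lin_0[OF lin_act])
  then show "M = {0} \<or> M = act g ` N"
    by (simp only: act_image_inverse(2)[OF pM g])
qed

lemma mod_iso_act:
  assumes N: "submod n (weyl_inv n K) N" and g: "g \<in> K"
  shows "mod_iso (weyl_inv n K) (act g ` N) N"
  unfolding mod_iso_def
proof (intro exI[of _ "act (ginv g)"] conjI ballI)
  have p: "N \<subseteq> polys n" using N by (simp add: submod_def)
  show "bij_betw (act (ginv g)) (act g ` N) N"
    using p g by (intro bij_betw_byWitness[where f' = "act g"]) (auto simp: act_ginv subset_eq)
  fix P b assume "P \<in> weyl_inv n K" "b \<in> act g ` N"
  moreover from this have "b \<in> polys n" using p g K_polys by auto
  ultimately show "act (ginv g) (P b) = P (act (ginv g) b)" using inv_act K_inv g by blast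
qed (rule lin_add[OF lin_act])

text \<open>
  The group commutes with the invariant operators, so the translates of \<open>N\<close> are simple and
  isomorphic to \<open>N\<close>. Conversely an isomorphism from \<open>N\<close> moves each vector within the span of its
  orbit. Hence the isotypic component is described by \<open>N\<close> and the group alone.
\<close>

lemma mod_component_eq_gspan:
  assumes N: "simple_submod n (weyl_inv n K) N"
  shows "mod_component n (weyl_inv n K) N = gspan K N"
proof
  have sub: "submod n (weyl_inv n K) N" and p: "N \<subseteq> polys n"
    using N by (auto simp: simple_submod_def submod_def)
  show "mod_component n (weyl_inv n K) N \<subseteq> gspan K N"
    unfolding mod_component_def
  proof (rule cpoly.span_minimal[OF _ subspace_gspan], clarify)
    fix M m assume M: "simple_submod n (weyl_inv n K) M" "mod_iso (weyl_inv n K) M N" and m: "m \<in> M"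
    have subM: "submod n (weyl_inv n K) M" using M by (simp add: simple_submod_def)
    obtain f where f: "bij_betw f M N" "\<And>P b. P \<in> weyl_inv n K \<Longrightarrow> b \<in> M \<Longrightarrow> f (P b) = P (f b)"
      using M(2) unfolding mod_iso_def by blast
    let ?h = "inv_into M f"
    have fm: "f m \<in> N" "?h (f m) = m" using f(1) m by (auto simp: bij_betw_def)
    have "?h (f m) \<in> gspan K {f m}"
    proof (rule linear_in_orbit_span[OF sub fm(1)])
      show "?h (f m) \<in> polys n" using fm m subM by (auto simp: submod_def)
      fix P assume P: "P \<in> weyl_inv n K"
      have "P m \<in> M" using P m subM by (simp add: submod_def)
      then have "?h (f (P m)) = P m" using f(1) by (simp add: bij_betw_def)
      then show "?h (P (f m)) = P (?h (f m))" using f(2)[OF P m] fm by simp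
    qed
    then show "m \<in> gspan K N" using fm gspan_mono[of "{f m}" N] by auto
  qed
  show "gspan K N \<subseteq> mod_component n (weyl_inv n K) N"
    unfolding gspan_def mod_component_def
    using simple_submod_act[OF N] mod_iso_act[OF sub]
    by (intro cpoly.span_mono) blast
qed

lemma inv_cyclic:
  assumes "simple_submod n (weyl_inv n K) N" "c \<in> N" "c \<noteq> 0" "a \<in> N"
  shows "\<exists>P\<in>weyl_inv n K. P c = a"
  using simple_submod_cyclic[OF assms(1)] inv_smul inv_add inv_comp assms(2-4) by blast

definition low_deg :: "cpoly set \<Rightarrow> nat" where
  "low_deg N = (LEAST d. N \<inter> hom_polys n d \<noteq> {0})"

lemma low_deg_least:
  assumes "submod n (weyl_inv n K) N" "N \<noteq> {0}"
  shows "N \<inter> hom_polys n (low_deg N) \<noteq> {0}" "e < low_deg N \<Longrightarrow> N \<inter> hom_polys n e = {0}"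
proof -
  have "0 \<in> N" using assms by (simp add: submod_def cpoly.subspace_0)
  then obtain b where b: "b \<in> N" "b \<noteq> 0" using assms(2) by blast
  then have "b \<in> polys n" using assms by (auto simp: submod_def)
  then obtain D where D: "b = (\<Sum>d\<le>D. hcomp d b)" using polys_eq_sum_hom by blast
  obtain d where "hcomp d b \<noteq> 0"
  proof (rule ccontr)
    assume "\<not> thesis"
    then have "hcomp d b = 0" for d using that by blast
    then show False using D b by simp
  qed
  moreover have "hcomp d b \<in> N \<inter> hom_polys n d"
    using submod_hcomp[OF assms(1) b(1)] hcomp_hom[OF \<open>b \<in> polys n\<close>] by simp
  ultimately have "N \<inter> hom_polys n d \<noteq> {0}" by blast
  then show "N \<inter> hom_polys n (low_deg N) \<noteq> {0}" unfolding low_deg_def by (rule LeastI)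
  show "e < low_deg N \<Longrightarrow> N \<inter> hom_polys n e = {0}" unfolding low_deg_def using not_less_Least by blast
qed

text \<open>
  Operators of negative degree annihilate the lowest graded piece for lack of room. A component in a
  higher degree \<open>j\<close> generates \<open>N\<close>, so some invariant operator takes it to a nonzero vector of
  lowest degree, and the part of degree \<open>low_deg N - j < 0\<close> of this operator does not kill it.
\<close>

lemma N_ann_eq:
  assumes N: "simple_submod n (weyl_inv n K) N"
  shows "N_ann n K N = N \<inter> hom_polys n (low_deg N)"
proof -
  have sub: "submod n (weyl_inv n K) N" "N \<noteq> {0}" using N by (auto simp: simple_submod_def)
  have N0: "0 \<in> N" and p: "N \<subseteq> polys n" using sub by (auto simp: submod_def cpoly.subspace_0)
  let ?d = "low_deg N"
  show ?thesis
  proof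
    show "N \<inter> hom_polys n ?d \<subseteq> N_ann n K N"
    proof
      fix b assume b: "b \<in> N \<inter> hom_polys n ?d"
      have "Q b = 0" if "Q \<in> weyl_inv n K" "weyl_homog n k Q" "k < 0" for Q k
      proof -
        have Qb: "Q b \<in> homz n (int ?d + k)" "Q b \<in> N"
          using weyl_homog_homz[OF that(2), of b "int ?d"] b that(1) sub by (auto simp: submod_def)
        show ?thesis
        proof (cases "int ?d + k < 0")
          case False
          then have "Q b \<in> N \<inter> hom_polys n (nat (int ?d + k))" using Qb by (simp add: homz_def)
          moreover have "nat (int ?d + k) < ?d" using that(3) False by linarith
          ultimately show ?thesis using low_deg_least(2)[OF sub] by blast
        qed (use Qb in \<open>simp add: homz_def\<close>)
      qed
      then show "b \<in> N_ann n K N"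
        using b by (auto simp: N_ann_def annihilated_def neg_part_def intro!: sum.neutral)
    qed
    show "N_ann n K N \<subseteq> N \<inter> hom_polys n ?d"
    proof
      fix b assume b: "b \<in> N_ann n K N"
      then have bN: "b \<in> N" by (simp add: N_ann_def annihilated_def)
      have ann: "Q b = 0" if "Q \<in> weyl_inv n K" "weyl_homog n k Q" "k < 0" for Q k
      proof -
        have "Q \<in> neg_part n (weyl_inv n K)"
          unfolding neg_part_def using that
          by (auto intro!: exI[of _ "{k}"] exI[of _ "\<lambda>_. Q"])
        then show ?thesis using b by (simp add: N_ann_def annihilated_def)
      qed
      obtain D where D: "b \<in> bdd_polys n D" using bN p polys_bdd by blast
      have "hcomp j b = 0" if "j \<noteq> ?d" for j
      proof (rule ccontr)
        assume nz: "hcomp j b \<noteq> 0"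
        have c: "hcomp j b \<in> N" "hcomp j b \<in> hom_polys n j"
          using submod_hcomp[OF sub(1) bN] hcomp_hom bN p by auto
        then have "\<not> j < ?d" using low_deg_least(2)[OF sub, of j] nz by blast
        then have "?d < j" using that by simp
        obtain a where a: "a \<in> N" "a \<in> hom_polys n ?d" "a \<noteq> 0"
          using low_deg_least(1)[OF sub] N0 cpoly.subspace_0[OF subspace_hom] by blast
        obtain P where P: "P \<in> weyl_inv n K" "P (hcomp j b) = a" using inv_cyclic[OF N c(1) nz a(1)] by blast
        \<comment> \<open>Unlike \<open>P\<close>, its graded piece \<open>Q\<close> sees only the component of \<open>b\<close> of degree \<open>j\<close>.\<close>
        obtain Q where Q: "Q \<in> weyl_inv n K" "weyl_homog n (int ?d - int j) Q" "Q b = hcomp ?d (P (hcomp j b))"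
          using op_component[OF P(1), of ?d j D] D by blast
        then have "Q b = a" using P(2) a(2) by (simp add: hcomp_id)
        moreover have "Q b = 0" by (rule ann[OF Q(1,2)]) (use \<open>?d < j\<close> in simp)
        ultimately show False using a(3) by simp
      qed
      then have "(\<Sum>j\<le>D. hcomp j b) = (\<Sum>j\<le>D. if j = ?d then hcomp j b else 0)"
        by (intro sum.cong) auto
      then have "b = (if ?d \<le> D then hcomp ?d b else 0)"
        using hcomp_sum[OF D] by simp
      moreover have "hcomp ?d b \<in> hom_polys n ?d" by (rule hcomp_hom) (use bN p in blast)
      ultimately have "b \<in> hom_polys n ?d"
        using cpoly.subspace_0[OF subspace_hom, of n ?d] by (cases "?d \<le> D") simp_all
      then show "b \<in> N \<inter> hom_polys n ?d" using bN by simp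
    qed
  qed
qed

lemma gspan_Int_hom:
  assumes N: "submod n (weyl_inv n K) N"
  shows "gspan K N \<inter> hom_polys n d = gspan K (N \<inter> hom_polys n d)"
proof
  have p: "N \<subseteq> polys n" using N by (simp add: submod_def)
  have "gspan K N \<subseteq> {x. hcomp d x \<in> gspan K (N \<inter> hom_polys n d)}"
    unfolding gspan_def[of _ N]
  proof (rule cpoly.span_minimal[OF _ lin_subspace_vimage[OF lin_hcomp subspace_gspan]], clarify)
    fix g b assume "g \<in> K" "b \<in> N"
    moreover from this have "hcomp d b \<in> N \<inter> hom_polys n d"
      using submod_hcomp[OF N] hcomp_hom p by auto
    ultimately show "hcomp d (act g b) \<in> gspan K (N \<inter> hom_polys n d)"
      using p act_in_gspan by (subst hcomp_act) auto
  qed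
  then show "gspan K N \<inter> hom_polys n d \<subseteq> gspan K (N \<inter> hom_polys n d)"
    using hcomp_id by fastforce
  show "gspan K (N \<inter> hom_polys n d) \<subseteq> gspan K N \<inter> hom_polys n d"
    using gspan_mono[of "N \<inter> hom_polys n d" N K] gspan_hom[of "N \<inter> hom_polys n d" d] by auto
qed

lemma gspan_0: "gspan K {0} = {0}"
proof
  show "gspan K {0} \<subseteq> {0}"
    by (rule gspan_least) (auto simp: stable_def lin_0[OF lin_act] cpoly.subspace_single_0)
qed (use cpoly.subspace_0[OF subspace_gspan] in auto)

lemma gspan_eq_0_iff:
  assumes "S \<subseteq> polys n" "0 \<in> S"
  shows "gspan K S = {0} \<longleftrightarrow> S = {0}"
  using gspan_superset[OF assms(1)] assms(2) gspan_0 by auto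

lemma orbit:
  assumes "a \<in> polys n"
  shows "a \<in> gspan K {a}" "stable K (gspan K {a})" "gspan K {a} \<subseteq> polys n"
  using gspan_superset[of "{a}"] stable_gspan[of "{a}"] gspan_polys[of "{a}"] assms by auto

lemma gspan_span: "S \<subseteq> polys n \<Longrightarrow> gspan K (cpoly.span S) = gspan K S"
proof
  assume S: "S \<subseteq> polys n"
  show "gspan K (cpoly.span S) \<subseteq> gspan K S"
    by (rule gspan_least[OF subspace_gspan stable_gspan[OF S] cpoly.span_minimal[OF gspan_superset[OF S] subspace_gspan]])
  show "gspan K S \<subseteq> gspan K (cpoly.span S)"
    by (rule gspan_mono) (rule cpoly.span_superset)
qed

lemma op_orbit_zero:
  assumes "P \<in> weyl_inv n K" "a \<in> polys n" "P a = 0" "u \<in> gspan K {a}"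
  shows "P u = 0"
  using op_gspan[OF assms(1), of "{a}" "{0}" u] assms gspan_0 cpoly.subspace_0[OF subspace_polys] by simp

lemma op_orbit:
  assumes "P \<in> weyl_inv n K" "a \<in> polys n" "u \<in> gspan K {a}"
  shows "P u \<in> gspan K {P a}"
  using op_gspan[OF assms(1), of "{a}" "{P a}" u] assms orbit(1)[OF inv_polys[OF assms(1,2)]] inv_polys[OF assms(1,2)]
  by simp

text \<open>
  The easy half of Schur's lemma: the kernel of an invariant operator on \<open>U\<close> is a subrepresentation.
\<close>

lemma irred_kernel:
  assumes P: "P \<in> weyl_inv n K" and U: "irred K U" "U \<subseteq> polys n" and u: "u \<in> U" "P u \<noteq> 0"
    and v: "v \<in> U" "P v = 0"
  shows "v = 0"
proof -
  let ?V = "{x \<in> U. P x = 0}"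
  have "?V = U \<inter> {x. P x \<in> {0}}" by blast
  then have "cpoly.subspace ?V"
    using lin_subspace_vimage[OF inv_lin[OF P] cpoly.subspace_single_0] U(1)
    by (simp add: irred_def cpoly.subspace_inter)
  moreover have "stable K ?V"
    using U P by (auto simp: irred_def stable_def inv_act[symmetric] lin_0[OF lin_act] subset_eq)
  ultimately have "?V = {0} \<or> ?V = U"
    by (rule irredD[OF U(1)]) blast
  then show ?thesis using u v by blast
qed

text \<open>
  An invariant operator that does not kill a generator of an irreducible representation is injective
  on it. Its linear left inverse is equivariant on the image, so it is again realised by an
  invariant operator.
\<close>

lemma op_inverse:
  assumes ap: "a \<in> polys n" and irr: "irred K (gspan K {a})"
    and P: "P \<in> weyl_inv n K" "P a \<noteq> 0"
  shows "\<exists>Q\<in>weyl_inv n K. Q (P a) = a"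
proof -
  let ?U = "gspan K {a}"
  have Pp: "P a \<in> polys n" by (rule inv_polys[OF P(1) ap])
  have "inj_on P ?U"
  proof (rule inj_onI)
    fix u v assume uv: "u \<in> ?U" "v \<in> ?U" "P u = P v"
    have "u - v = 0"
      by (rule irred_kernel[OF P(1) irr orbit(3)[OF ap] orbit(1)[OF ap] P(2)])
        (use uv in \<open>simp_all add: cpoly.subspace_diff[OF subspace_gspan] lin_diff[OF inv_lin[OF P(1)]]\<close>)
    then show "u = v" by simp
  qed
  then obtain h where h: "h ` UNIV \<subseteq> ?U" "lin h" "\<And>u. u \<in> ?U \<Longrightarrow> h (P u) = u"
    using cpoly_pair.linear_exists_left_inverse_on[OF inv_lin[OF P(1)] subspace_gspan] by blast
  have im: "gspan K {P a} \<subseteq> P ` ?U"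
  proof (rule gspan_least)
    show "cpoly.subspace (P ` ?U)" by (rule lin_subspace_image[OF inv_lin[OF P(1)] subspace_gspan])
    show "stable K (P ` ?U)"
      using orbit(2,3)[OF ap] by (auto simp: stable_def inv_act[OF P(1)] subset_eq)
    show "{P a} \<subseteq> P ` ?U" using orbit(1)[OF ap] by simp
  qed
  obtain D where D: "P a \<in> bdd_polys n D" using Pp polys_bdd by blast
  have "\<exists>Q\<in>weyl_inv n K. \<forall>b\<in>gspan K {P a}. Q b = h b"
  proof (rule extension_op[OF h(2)])
    show "h b \<in> polys n" for b using h(1) orbit(3)[OF ap] by blast
    show "gspan K {P a} \<subseteq> bdd_polys n D" using D by (intro gspan_bdd) simp
    fix g b assume g: "g \<in> K" and "b \<in> gspan K {P a}"
    then obtain u where u: "u \<in> ?U" "b = P u" using im by blast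
    have gu: "act g u \<in> ?U" using orbit(2)[OF ap] g u by (simp add: stable_def)
    have "act g b = P (act g u)" using u orbit(3)[OF ap] by (simp add: inv_act[OF P(1) g] subset_eq)
    then show "h (act g b) = act g (h b)" using h(3) u gu by simp
  qed
  then show ?thesis using orbit(1)[OF Pp] h(3)[OF orbit(1)[OF ap]] by metis
qed

lemma orbit_image:
  assumes ap: "a \<in> polys n" and irr: "irred K (gspan K {a})"
    and P: "P \<in> weyl_inv n K" "P a \<noteq> 0"
  shows "irred K (gspan K {P a})"
    and "rep_iso (mat_group n K) (poly_rep (gspan K {P a})) (poly_rep (gspan K {a}))"
proof -
  let ?U = "gspan K {a}" and ?V = "gspan K {P a}"
  have Pp: "P a \<in> polys n" by (rule inv_polys[OF P(1) ap])
  obtain Q where Q: "Q \<in> weyl_inv n K" "Q (P a) = a" using op_inverse[OF ap irr P] by blast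
  have PU: "P u \<in> ?V" if "u \<in> ?U" for u by (rule op_orbit[OF P(1) ap that])
  have QV: "Q v \<in> ?U" if "v \<in> ?V" for v using op_orbit[OF Q(1) Pp that] Q(2) by simp
  have R: "(\<lambda>b. Q (P b) + smul (- 1) b) \<in> weyl_inv n K" "(\<lambda>b. P (Q b) + smul (- 1) b) \<in> weyl_inv n K"
    by (rule inv_add[OF inv_comp[OF Q(1) P(1)] inv_smul], rule inv_add[OF inv_comp[OF P(1) Q(1)] inv_smul])
  have QP: "Q (P u) = u" if "u \<in> ?U" for u
    using op_orbit_zero[OF R(1) ap _ that] Q(2) by simp
  have PQ: "P (Q v) = v" if "v \<in> ?V" for v
    using op_orbit_zero[OF R(2) Pp _ that] Q(2) by simp
  show "irred K ?V"
    unfolding irred_def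
  proof (intro conjI allI impI)
    show "cpoly.subspace ?V" by (rule subspace_gspan)
    show "stable K ?V" by (rule orbit(2)[OF Pp])
    show "?V \<noteq> {0}" using orbit(1)[OF Pp] P(2) by auto
    fix M assume M: "cpoly.subspace M" "stable K M" "M \<subseteq> ?V"
    have "cpoly.subspace (Q ` M)" by (rule lin_subspace_image[OF inv_lin[OF Q(1)] M(1)])
    moreover have "stable K (Q ` M)"
      using M orbit(3)[OF Pp] by (auto simp: stable_def inv_act[OF Q(1)] subset_eq)
    moreover have "Q ` M \<subseteq> ?U" using QV M(3) by auto
    ultimately have "Q ` M = {0} \<or> Q ` M = ?U" using irr by (simp add: irred_def)
    then have "P ` Q ` M = {0} \<or> P ` Q ` M = P ` ?U"
      by (elim disjE) (simp_all add: lin_0[OF inv_lin[OF P(1)]])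
    moreover have "P ` Q ` M = M" using PQ M(3) by (force simp: image_image)
    moreover have "P ` ?U = ?V" using PU QV PQ by force
    ultimately show "M = {0} \<or> M = ?V" by simp
  qed
  show "rep_iso (mat_group n K) (poly_rep ?V) (poly_rep ?U)"
  proof (rule rep_iso_inverse[of P])
    show "bij_betw P (Space (poly_rep ?U)) (Space (poly_rep ?V))"
      using PU QV PQ QP by (intro bij_betw_byWitness[where f' = Q]) auto
  qed (use orbit(2,3)[OF ap] in \<open>auto simp: lin_add[OF inv_lin[OF P(1)]] lin_smul[OF inv_lin[OF P(1)]]
      stable_def inv_act[OF P(1)] subset_eq intro: cpoly.subspace_add cpoly.subspace_scale subspace_gspan\<close>)
qed

end

section \<open>Simple modules over the invariant operators of degree zero\<close>

text \<open>
  The situation of the theorem with \<open>K = G\<close>: by \<open>N_ann_eq\<close> the annihilated part \<open>A\<close> lies in a single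
  degree \<open>d\<close>. The invariant operators of degree zero act on the polynomials of degree \<open>d\<close> as the
  full algebra of equivariant endomorphisms, so that \<open>A\<close> is of the form \<open>M \<otimes> w\<close> with a vector \<open>w\<close> of an
  irreducible representation of \<open>K\<close> and its multiplicity space \<open>M\<close>. The lemmas below express the
  consequences of this without tensor products.
\<close>

locale simple_deg0_module = finite_linear_group +
  fixes d :: nat and A :: "cpoly set"
  assumes A_hom: "A \<subseteq> hom_polys n d"
    and A_simple: "simple_submod n (deg0_part n (weyl_inv n K)) A"
begin

lemma A_polys: "A \<subseteq> polys n"
  using A_hom hom_subset_polys by blast

lemma subspace_A: "cpoly.subspace A"
  using A_simple by (simp add: simple_submod_def submod_def)

lemma deg0_closed:
  "smul c \<in> deg0_part n (weyl_inv n K)"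
  "P \<in> deg0_part n (weyl_inv n K) \<Longrightarrow> Q \<in> deg0_part n (weyl_inv n K) \<Longrightarrow> (\<lambda>b. P b + Q b) \<in> deg0_part n (weyl_inv n K)"
  "P \<in> deg0_part n (weyl_inv n K) \<Longrightarrow> Q \<in> deg0_part n (weyl_inv n K) \<Longrightarrow> (\<lambda>b. P (Q b)) \<in> deg0_part n (weyl_inv n K)"
  using inv_smul inv_add inv_comp weyl_homog.scalar weyl_homog.add weyl_homog.comp[of n 0 P 0 Q]
  by (auto simp: deg0_part_def)

lemma deg0_inv: "P \<in> deg0_part n (weyl_inv n K) \<Longrightarrow> P \<in> weyl_inv n K"
  by (simp add: deg0_part_def)

lemma deg0_diff:
  assumes "P \<in> deg0_part n (weyl_inv n K)"
  shows "(\<lambda>b. b - P b) \<in> deg0_part n (weyl_inv n K)"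
proof -
  have "(\<lambda>b. smul 1 b + smul (- 1) (P b)) \<in> deg0_part n (weyl_inv n K)"
    by (rule deg0_closed(2)[OF deg0_closed(1) deg0_closed(3)[OF deg0_closed(1) assms]])
  then show ?thesis by simp
qed

lemma deg0_A: "P \<in> deg0_part n (weyl_inv n K) \<Longrightarrow> a \<in> A \<Longrightarrow> P a \<in> A"
  using A_simple by (simp add: simple_submod_def submod_def)

lemma deg0_cyclic:
  assumes "c \<in> A" "c \<noteq> 0" "a \<in> A"
  shows "\<exists>P\<in>deg0_part n (weyl_inv n K). P c = a"
  using simple_submod_cyclic[OF A_simple] deg0_closed assms by blast

text \<open>
  Let \<open>P\<close> be an equivariant projection onto a subrepresentation \<open>V\<close> of the orbit span of \<open>a\<close>. If
  \<open>P a = 0\<close> then \<open>P = 0\<close> on the orbit span, so \<open>V = 0\<close>. Otherwise simplicity of \<open>A\<close> gives \<open>Q\<close> with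
  \<open>Q (P a) = a\<close>; then \<open>Q P = 1\<close> on the orbit span, so \<open>P\<close> is injective there, and the projection
  is the identity.
\<close>

lemma irred_orbit:
  assumes a: "a \<in> A" "a \<noteq> 0"
  shows "irred K (gspan K {a})"
  unfolding irred_def
proof (intro conjI allI impI)
  let ?U = "gspan K {a}"
  have ap: "a \<in> polys n" and ah: "a \<in> hom_polys n d" using a A_polys A_hom by auto
  show "cpoly.subspace ?U" by (rule subspace_gspan)
  show "stable K ?U" by (rule orbit(2)[OF ap])
  show "?U \<noteq> {0}" using orbit(1)[OF ap] a by auto
  fix V assume V: "cpoly.subspace V" "stable K V" "V \<subseteq> ?U"
  have Uh: "?U \<subseteq> hom_polys n d" using gspan_hom[of "{a}" d] ah by simp
  obtain P where P: "P \<in> deg0_part n (weyl_inv n K)" "\<forall>s\<in>V. P s = s" "\<forall>b\<in>hom_polys n d. P b \<in> V"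
    using projection_op_homog[OF V(1,2), of d] V(3) Uh by blast
  show "V = {0} \<or> V = ?U"
  proof (cases "P a = 0")
    case True
    then have "\<forall>u\<in>V. u = 0"
      using op_orbit_zero[OF deg0_inv[OF P(1)] ap True] P(2) V(3) by fastforce
    then show ?thesis using cpoly.subspace_0[OF V(1)] by blast
  next
    case False
    then obtain Q where Q: "Q \<in> deg0_part n (weyl_inv n K)" "Q (P a) = a"
      using deg0_cyclic[OF deg0_A[OF P(1) a(1)] _ a(1)] by blast
    let ?R = "\<lambda>b. b - Q (P b)"
    have R: "?R \<in> weyl_inv n K"
      using deg0_inv[OF deg0_diff[OF deg0_closed(3)[OF Q(1) P(1)]]] .
    have Pa: "P a \<in> V" using P(3) ah by simp
    then have "P a \<in> ?U" using V(3) by (rule subsetD[rotated])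
    then have "a - P a \<in> ?U"
      by (rule cpoly.subspace_diff[OF subspace_gspan orbit(1)[OF ap]])
    moreover have "?R a = 0" unfolding Q(2) by (rule diff_self)
    ultimately have R0: "?R (a - P a) = 0"
      using op_orbit_zero[OF R ap] by blast
    have "P (a - P a) = P a - P (P a)"
      by (rule lin_diff[OF inv_lin[OF deg0_inv[OF P(1)]]])
    also have "P (P a) = P a" using P(2) Pa by (rule bspec)
    finally have "Q (P (a - P a)) = 0"
      by (simp only: diff_self lin_0[OF inv_lin[OF deg0_inv[OF Q(1)]]])
    with R0 have "a = P a"
      by (simp only: diff_zero right_minus_eq)
    then have "{a} \<subseteq> V" using Pa by simp
    then have "?U \<subseteq> V" by (rule gspan_least[OF V(1,2)])
    then show ?thesis using V(3) by blast
  qed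
qed

text \<open>
  For \<open>a \<noteq> 0\<close> the vector \<open>s\<close> is \<open>P a\<close> for an operator \<open>P\<close> of degree zero, which preserves the
  irreducible space spanned by the orbit of \<open>a\<close>. By the existence of an eigenvalue, \<open>P\<close> is a scalar
  there.
\<close>

lemma schur:
  assumes a: "a \<in> A" and s: "s \<in> A" "s \<in> gspan K {a}"
  shows "\<exists>c. s = smul c a"
proof (cases "a = 0")
  case True
  then show ?thesis using s gspan_0 by auto
next
  case False
  let ?U = "gspan K {a}"
  have ap: "a \<in> polys n" using a A_polys by auto
  obtain P where P: "P \<in> deg0_part n (weyl_inv n K)" "P a = s" using deg0_cyclic[OF a False s(1)] by blast
  note Pi = deg0_inv[OF P(1)]
  have "{s} \<subseteq> ?U" using s by simp
  then have "gspan K {s} \<subseteq> ?U"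
    by (rule gspan_least[OF subspace_gspan orbit(2)[OF ap]])
  then have PU: "P u \<in> ?U" if "u \<in> ?U" for u
    using op_orbit[OF Pi ap that] P(2) by auto
  have "?U = cpoly.span ((\<lambda>g. act g a) ` K)"
    unfolding gspan_def by (rule arg_cong[of _ _ cpoly.span]) blast
  then have "finite ((\<lambda>g. act g a) ` K)" "?U \<subseteq> cpoly.span ((\<lambda>g. act g a) ` K)"
    using fin by auto
  from eigenvector_exists[OF inv_lin[OF Pi] subspace_gspan PU this orbit(1)[OF ap] False]
  obtain c w where w: "w \<in> ?U" "w \<noteq> 0" "P w = smul c w" by blast
  have R: "(\<lambda>b. P b + smul (- c) b) \<in> weyl_inv n K"
    by (intro inv_add Pi inv_smul)
  have "P a + smul (- c) a = 0"
    using irred_kernel[OF R irred_orbit[OF a False] orbit(3)[OF ap] orbit(1)[OF ap] _ w(1)] w by auto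
  then show ?thesis using P(2) by (auto simp: add_eq_0_iff)
qed

text \<open>
  Linear independence in \<open>A\<close> implies independence of the orbit spans. In the induction step an
  equivariant projection \<open>P\<close> onto the orbit span of \<open>T\<close> is split off: \<open>1 - P\<close> maps \<open>a\<close> into the
  orbit span of \<open>(1 - P) t\<close>, where Schur's lemma applies.
\<close>

lemma A_Int_gspan:
  assumes "finite T" "T \<subseteq> A" "a \<in> A" "a \<in> gspan K T"
  shows "a \<in> cpoly.span T"
  using assms
proof (induction T arbitrary: a rule: finite_induct)
  case empty
  then show ?case by (simp add: gspan_def)
next
  case (insert t T)
  let ?S = "gspan K T"
  have TA: "T \<subseteq> A" "t \<in> A" and Tp: "T \<subseteq> polys n" "t \<in> polys n"
    and Th: "T \<subseteq> hom_polys n d" using insert.prems A_polys A_hom by auto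
  obtain P where P: "P \<in> deg0_part n (weyl_inv n K)" "\<forall>s\<in>?S. P s = s" "\<forall>b\<in>hom_polys n d. P b \<in> ?S"
    using projection_op_homog[OF subspace_gspan stable_gspan[OF Tp(1)] gspan_hom[OF Th]] by blast
  let ?R = "\<lambda>b. b - P b"
  have R: "?R \<in> deg0_part n (weyl_inv n K)" by (rule deg0_diff[OF P(1)])
  have linR: "lin ?R" using inv_lin[OF deg0_inv[OF R]] .
  have Rt: "?R t \<in> A" "?R t \<in> polys n" using deg0_A[OF R TA(2)] A_polys by auto
  have "?R s \<in> gspan K {?R t}" if "s \<in> insert t T" for s
  proof (cases "s = t")
    case True
    then show ?thesis using orbit(1)[OF Rt(2)] by simp
  next
    case False
    then have "s \<in> ?S" using that gspan_superset[OF Tp(1)] by auto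
    then show ?thesis using P(2) cpoly.subspace_0[OF subspace_gspan] by simp
  qed
  from op_gspan[OF deg0_inv[OF R] _ _ this insert.prems(3)]
  have "?R a \<in> gspan K {?R t}" using Tp Rt by simp
  then obtain c where c: "?R a = smul c (?R t)" using schur[OF Rt(1) deg0_A[OF R insert.prems(2)]] by blast
  let ?x = "a - smul c t"
  have x: "?x \<in> A" using insert.prems TA subspace_A by (simp add: cpoly.subspace_diff cpoly.subspace_scale)
  have "?R ?x = 0" using c by (simp only: lin_diff[OF linR] lin_smul[OF linR] diff_self)
  then have "?x = P ?x" by simp
  moreover have "P ?x \<in> ?S" using P(3) x A_hom by blast
  ultimately have "?x \<in> ?S" by simp
  then have "?x \<in> cpoly.span T" by (rule insert.IH[OF TA(1) x])
  then show ?case by (auto simp: cpoly.span_breakdown_eq)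
qed

text \<open>
  Choose operators \<open>P i\<close> of degree zero with \<open>P i a\<close> equal to the \<open>i\<close>-th element \<open>e i\<close> of the basis \<open>B\<close>.
  Each of them maps the orbit span of \<open>a\<close> isomorphically to that of \<open>e i\<close>, and the sum of these
  spans is direct by \<open>A_Int_gspan\<close>. So the tuple \<open>w\<close> corresponds to the sum of the \<open>P i (w i)\<close>.
\<close>

lemma gspan_A_iso:
  assumes B: "B \<subseteq> A" "cpoly.independent B" "A \<subseteq> cpoly.span B" "card B = r" and a: "a \<in> A" "a \<noteq> 0"
  shows "rep_iso (mat_group n K) (poly_rep (gspan K A)) (rep_power r (poly_rep (gspan K {a})))"
proof -
  let ?U = "gspan K {a}"
  have Bp: "B \<subseteq> polys n" using B A_polys by blast
  have ap: "a \<in> polys n" using a A_polys by blast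
  obtain e where e: "bij_betw e {..<r} B"
    using ex_bij_betw_nat_finite[OF finite_independent_hom[OF order_trans[OF B(1) A_hom] B(2)]] B(4) by (auto simp: atLeast0LessThan)
  have eB: "e i \<in> B" if "i < r" for i using e that by (auto simp: bij_betw_def)
  have "\<forall>i\<in>{..<r}. \<exists>P. P \<in> deg0_part n (weyl_inv n K) \<and> P a = e i"
    using deg0_cyclic[OF a] eB B(1) by blast
  then obtain P where P0: "\<And>i. i < r \<Longrightarrow> P i \<in> deg0_part n (weyl_inv n K) \<and> P i a = e i"
    by (metis bchoice lessThan_iff)
  have P: "P i \<in> weyl_inv n K" "P i a = e i" if "i < r" for i using P0[OF that] deg0_inv by auto
  note linP = inv_lin[OF P(1)]
  let ?F = "\<lambda>k w. \<Sum>i<k. P i (w i)"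
  let ?R = "rep_power r (poly_rep ?U)"
  have Sp: "Space ?R = {w. (\<forall>i<r. w i \<in> ?U) \<and> (\<forall>i\<ge>r. w i = 0)}" by (simp add: rep_power_def)
  have Pe: "P i u \<in> gspan K {e i}" if "i < r" "u \<in> ?U" for i u
    using op_orbit[OF P(1)[OF that(1)] ap that(2)] P(2)[OF that(1)] by simp
  have F_mem: "?F k w \<in> gspan K (e ` {..<k})" if "k \<le> r" "\<And>i. i < k \<Longrightarrow> w i \<in> ?U" for k w
  proof (rule cpoly.subspace_sum[OF subspace_gspan])
    fix i assume "i \<in> {..<k}"
    then show "P i (w i) \<in> gspan K (e ` {..<k})"
      using Pe[of i "w i"] that gspan_mono[of "{e i}" "e ` {..<k}" K] by auto
  qed
  have e0: "e i \<noteq> 0" if "i < r" for i using eB[OF that] B(2) cpoly.dependent_zero by metis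
  \<comment> \<open>Induction on the length of the sum: a nonzero last term would put \<open>e k\<close> into the orbit span of its predecessors.\<close>
  have inj0: "\<forall>i<k. w i = 0" if "k \<le> r" "\<And>i. i < k \<Longrightarrow> w i \<in> ?U" "?F k w = 0" for k w
    using that
  proof (induction k)
    case (Suc k)
    have k: "k < r" using Suc.prems by simp
    have ek: "e k \<in> A" "e k \<in> polys n" using eB[OF k] B(1) Bp by auto
    have "w k = 0"
    proof (rule ccontr)
      assume nz: "w k \<noteq> 0"
      let ?y = "P k (w k)" and ?V = "gspan K {e k} \<inter> gspan K (e ` {..<k})"
      have "e ` {..<k} \<subseteq> B" using eB k by auto
      then have ekp: "e ` {..<k} \<subseteq> polys n" "e ` {..<k} \<subseteq> A" using Bp B(1) by auto
      have y0: "?y \<noteq> 0"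
        using irred_kernel[OF P(1)[OF k] irred_orbit[OF a] orbit(3)[OF ap] orbit(1)[OF ap], of "w k"]
          P(2)[OF k] e0[OF k] nz Suc.prems(2)[of k] by auto
      have "?y = - ?F k w" using Suc.prems(3) by (simp add: eq_neg_iff_add_eq_0 add.commute)
      moreover have "?F k w \<in> gspan K (e ` {..<k})" using F_mem[of k w] Suc.prems by simp
      ultimately have "?y \<in> gspan K (e ` {..<k})" by (simp add: cpoly.subspace_neg[OF subspace_gspan])
      then have "?y \<in> ?V" using Pe[OF k] Suc.prems(2)[of k] by simp
      moreover have "cpoly.subspace ?V" by (intro cpoly.subspace_inter subspace_gspan)
      moreover have "stable K ?V"
        using orbit(2)[OF ek(2)] stable_gspan[OF ekp(1)] by (auto simp: stable_def)
      ultimately have "?V = gspan K {e k}"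
        using irredD[OF irred_orbit[OF ek(1) e0[OF k]], of ?V] y0 by blast
      then have "e k \<in> gspan K (e ` {..<k})" using orbit(1)[OF ek(2)] by blast
      then have "e k \<in> cpoly.span (e ` {..<k})"
        by (intro A_Int_gspan ek ekp) auto
      moreover have "e ` {..<k} \<subseteq> B - {e k}"
        using e k eB by (auto simp: bij_betw_def inj_on_def)
      ultimately have "e k \<in> cpoly.span (B - {e k})" using cpoly.span_mono by blast
      then show False using B(2) eB[OF k] by (auto simp: cpoly.dependent_def)
    qed
    moreover from this have Fk: "?F k w = 0" using Suc.prems(3) by (simp add: lin_0[OF linP[OF k]])
    have "\<forall>i<k. w i = 0"
      by (rule Suc.IH[OF _ _ Fk]) (use Suc.prems(1,2) in simp_all)
    ultimately show ?case by (simp add: less_Suc_eq)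
  qed simp
  have add: "u + v \<in> Space ?R \<and> ?F r (u + v) = ?F r u + ?F r v"
    if "u \<in> Space ?R" "v \<in> Space ?R" for u v
    using that by (auto simp: Sp sum.distrib lin_add[OF linP] intro: cpoly.subspace_add subspace_gspan)
  have scal: "scal ?R c u \<in> Space ?R \<and> ?F r (scal ?R c u) = smul c (?F r u)" if "u \<in> Space ?R" for c u
    using that by (auto simp: rep_power_def cpoly.scale_sum_right lin_smul[OF linP]
        intro: cpoly.subspace_scale subspace_gspan)
  have gact: "gact ?R g u \<in> Space ?R \<and> ?F r (gact ?R g u) = act g (?F r u)" if "g \<in> K" "u \<in> Space ?R" for g u
  proof
    show "gact ?R g u \<in> Space ?R" using that orbit(2)[OF ap] by (auto simp: rep_power_def stable_def)
    have "P i (act g (u i)) = act g (P i (u i))" if "i < r" for i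
      using inv_act[OF P(1)[OF that] \<open>g \<in> K\<close>, of "u i"] \<open>u \<in> Space ?R\<close> orbit(3)[OF ap] that by (auto simp: Sp)
    then show "?F r (gact ?R g u) = act g (?F r u)"
      by (simp add: rep_power_def lin_sum[OF lin_act])
  qed
  have span: "gspan K A = gspan K B"
  proof -
    have "cpoly.span B \<subseteq> A" by (rule cpoly.span_minimal[OF B(1) subspace_A])
    then have "A = cpoly.span B" using B(3) by blast
    then show ?thesis using gspan_span[OF Bp] by simp
  qed
  have eimg: "e ` {..<r} = B" using e by (simp add: bij_betw_def)
  have "bij_betw (?F r) (Space ?R) (gspan K A)"
    unfolding bij_betw_def
  proof
    show "inj_on (?F r) (Space ?R)"
    proof (rule inj_onI)
      fix u v assume uv: "u \<in> Space ?R" "v \<in> Space ?R" "?F r u = ?F r v"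
      let ?w = "\<lambda>i. u i - v i"
      have "?F r ?w = ?F r u - ?F r v" by (simp add: lin_diff[OF linP] sum_subtractf)
      then have "\<forall>i<r. ?w i = 0"
        using uv by (intro inj0) (auto simp: Sp intro: cpoly.subspace_diff subspace_gspan)
      then show "u = v" using uv by (intro ext) (metis (mono_tags, lifting) Sp eq_iff_diff_eq_0 mem_Collect_eq not_le)
    qed
    show "?F r ` Space ?R = gspan K A"
    proof
      show "?F r ` Space ?R \<subseteq> gspan K A"
        using F_mem[of r] eimg span by (auto simp: Sp)
      show "gspan K A \<subseteq> ?F r ` Space ?R" unfolding span
      proof (rule gspan_least)
        show "cpoly.subspace (?F r ` Space ?R)"
        proof (rule cpoly.subspaceI)
          have "(\<lambda>i. 0) \<in> Space ?R" by (simp add: Sp cpoly.subspace_0[OF subspace_gspan])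
          moreover have "?F r (\<lambda>i. 0) = 0" by (simp add: lin_0[OF linP])
          ultimately show "0 \<in> ?F r ` Space ?R" by (intro image_eqI[of _ _ "\<lambda>i. 0"]) simp_all
        next
          fix x y assume "x \<in> ?F r ` Space ?R" "y \<in> ?F r ` Space ?R"
          then obtain u v where "u \<in> Space ?R" "x = ?F r u" "v \<in> Space ?R" "y = ?F r v" by blast
          then show "x + y \<in> ?F r ` Space ?R" using add[of u v] by (intro image_eqI[of _ _ "u + v"]) auto
        next
          fix c x assume "x \<in> ?F r ` Space ?R"
          then obtain u where "u \<in> Space ?R" "x = ?F r u" by blast
          then show "smul c x \<in> ?F r ` Space ?R" using scal[of u c] by (intro image_eqI[of _ _ "scal ?R c u"]) auto
        qed
        show "stable K (?F r ` Space ?R)"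
          unfolding stable_def
        proof clarify
          fix g u assume "g \<in> K" "u \<in> Space ?R"
          then show "act g (?F r u) \<in> ?F r ` Space ?R"
            using gact[of g u] by (intro image_eqI[of _ _ "gact ?R g u"]) auto
        qed
        show "B \<subseteq> ?F r ` Space ?R"
        proof
          fix b assume "b \<in> B"
          then obtain i where i: "i < r" "b = e i" using eimg by blast
          let ?w = "\<lambda>j. if j = i then a else 0"
          have "?w \<in> Space ?R" using i orbit(1)[OF ap] by (auto simp: Sp cpoly.subspace_0[OF subspace_gspan])
          moreover have "?F r ?w = (\<Sum>j<r. if j = i then b else 0)"
            by (intro sum.cong) (auto simp: P(2) i lin_0[OF linP])
          ultimately show "b \<in> ?F r ` Space ?R" using i by (intro image_eqI[of _ _ ?w]) auto
        qed
      qed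
    qed
  qed
  then show ?thesis
    using rep_iso_inverse[of "?F r" ?R "poly_rep (gspan K A)" "mat_group n K"] add scal gact by simp
qed

text \<open>
  As all of \<open>A\<close> is reached from \<open>a\<close> by operators of degree zero, one generator suffices.
\<close>

lemma generated_eq:
  assumes a: "a \<in> A" "a \<noteq> 0"
  shows "generated (weyl_inv n K) A = {P a | P. P \<in> weyl_inv n K}" (is "_ = ?J")
proof
  have sub: "cpoly.subspace ?J"
  proof (rule cpoly.subspaceI)
    show "0 \<in> ?J" using inv_smul[of 0] by (auto intro!: exI[of _ "smul 0"])
    fix x y assume "x \<in> ?J" "y \<in> ?J"
    then show "x + y \<in> ?J" using inv_add by fastforce
  next
    fix k x assume "x \<in> ?J"
    then show "smul k x \<in> ?J" using inv_comp[OF inv_smul] by fastforce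
  qed
  show "generated (weyl_inv n K) A \<subseteq> ?J"
    unfolding generated_def
  proof (rule cpoly.span_minimal[OF _ sub], clarify)
    fix P b assume P: "P \<in> weyl_inv n K" and "b \<in> A"
    then obtain Q where "Q \<in> deg0_part n (weyl_inv n K)" "Q a = b" using deg0_cyclic[OF a] by blast
    then show "\<exists>Pa. P b = Pa a \<and> Pa \<in> weyl_inv n K"
      using inv_comp[OF P deg0_inv] by (intro exI[of _ "\<lambda>x. P (Q x)"]) simp
  qed
  show "?J \<subseteq> generated (weyl_inv n K) A"
    unfolding generated_def using a by (auto intro!: cpoly.span_base)
qed

text \<open>
  Every nonzero element has the form \<open>P a\<close>, and \<open>op_inverse\<close> leads back from it to the generator.
\<close>

lemma generated_simple:
  assumes a: "a \<in> A" "a \<noteq> 0"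
  shows "simple_submod n (weyl_inv n K) (generated (weyl_inv n K) A)"
proof -
  let ?J = "generated (weyl_inv n K) A"
  note J = generated_eq[OF a]
  have ap: "a \<in> polys n" using a A_polys by auto
  have "cpoly.subspace ?J" by (simp add: generated_def)
  moreover have "?J \<subseteq> polys n" unfolding J using inv_polys ap by auto
  moreover have "P b \<in> ?J" if P: "P \<in> weyl_inv n K" and "b \<in> ?J" for P b
  proof -
    from that obtain Q where "Q \<in> weyl_inv n K" "b = Q a" unfolding J by blast
    then show ?thesis unfolding J using inv_comp[OF P] by fastforce
  qed
  ultimately have "submod n (weyl_inv n K) ?J" by (auto simp: submod_def)
  moreover have aJ: "a \<in> ?J" unfolding J using inv_smul[of 1] by (auto intro!: exI[of _ "smul 1"])
  moreover have "M = {0} \<or> M = ?J" if M: "submod n (weyl_inv n K) M" "M \<subseteq> ?J" for M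
  proof (cases "M \<subseteq> {0}")
    case True
    then show ?thesis using M(1) by (auto simp: submod_def cpoly.subspace_0)
  next
    case False
    then obtain P where P: "P \<in> weyl_inv n K" "P a \<in> M" "P a \<noteq> 0" using M(2) unfolding J by blast
    then obtain Q where "Q \<in> weyl_inv n K" "Q (P a) = a" using op_inverse[OF ap irred_orbit[OF a]] by blast
    then have "a \<in> M" using M(1) P(2) unfolding submod_def by metis
    then have "?J \<subseteq> M" unfolding J using M(1) by (auto simp: submod_def)
    then show ?thesis using M(2) by blast
  qed
  ultimately show ?thesis using a unfolding simple_submod_def by blast
qed

text \<open>
  Both isotypic components equal the span of the translates of \<open>J = D\<^sup>G A\<close>. A copy of the
  representation \<open>U\<close> generated by \<open>a\<close> is the image of \<open>U\<close> under an equivariant map, hence under an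
  invariant operator \<open>P\<close>, so that it is generated by \<open>P a \<in> J\<close>. Conversely a nonzero element of \<open>J\<close>
  is of the form \<open>P a\<close>, and \<open>P\<close> maps \<open>U\<close> isomorphically to the span of its orbit.
\<close>

lemma generated_corresponds:
  assumes a: "a \<in> A" "a \<noteq> 0"
  shows "corresponds n K (generated (weyl_inv n K) A) (poly_rep (gspan K {a}))"
proof -
  let ?J = "generated (weyl_inv n K) A" and ?U = "gspan K {a}"
  have ap: "a \<in> polys n" using a A_polys by auto
  have J: "simple_submod n (weyl_inv n K) ?J" by (rule generated_simple[OF a])
  then have Jp: "?J \<subseteq> polys n" by (simp add: simple_submod_def submod_def)
  have "rep_component n K (poly_rep ?U) = gspan K ?J"
  proof
    show "rep_component n K (poly_rep ?U) \<subseteq> gspan K ?J"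
      unfolding rep_component_def
    proof (rule cpoly.span_minimal[OF _ subspace_gspan], clarify)
      fix M x
      assume M: "invariant_subspace (mat_group n K) (poly_rep (polys n)) M"
        and iso: "rep_iso (mat_group n K) (poly_rep M) (poly_rep ?U)" and x: "x \<in> M"
      have Ms: "cpoly.subspace M" "M \<subseteq> polys n" "stable K M" using M by (auto simp: invariant_subspace_iff)
      obtain f where f: "bij_betw f M ?U" "\<And>u v. u \<in> M \<Longrightarrow> v \<in> M \<Longrightarrow> f (u + v) = f u + f v"
        "\<And>c u. u \<in> M \<Longrightarrow> f (smul c u) = smul c (f u)"
        "\<And>g u. g \<in> K \<Longrightarrow> u \<in> M \<Longrightarrow> f (act g u) = act g (f u)"
        using iso unfolding rep_iso_def by auto
      let ?h = "inv_into M f"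
      have h: "?h u \<in> M" "f (?h u) = u" if "u \<in> ?U" for u
        using that f(1) by (auto simp: bij_betw_def inv_into_into f_inv_into_f)
      have hf: "?h (f m) = m" if "m \<in> M" for m using f(1) that by (simp add: bij_betw_def)
      have h_add: "?h (u + v) = ?h u + ?h v" if "u \<in> ?U" "v \<in> ?U" for u v
        using f(2)[of "?h u" "?h v"] hf[of "?h u + ?h v"] h that Ms by (simp add: cpoly.subspace_add)
      have h_smul: "?h (smul c u) = smul c (?h u)" if "u \<in> ?U" for c u
        using f(3)[of "?h u" c] hf[of "smul c (?h u)"] h that Ms by (simp add: cpoly.subspace_scale)
      have h_act: "?h (act g u) = act g (?h u)" if "u \<in> ?U" "g \<in> K" for g u
        using f(4)[of g "?h u"] hf[of "act g (?h u)"] h that Ms by (simp add: stable_def)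
      \<comment> \<open>The isomorphism is defined only on \<open>U\<close>; a projection extends it to a linear map on all polynomials.\<close>
      obtain \<pi> where \<pi>: "lin \<pi>" "range \<pi> \<subseteq> ?U" "\<forall>s\<in>?U. \<pi> s = s"
        using projection_exists[OF subspace_gspan] by blast
      have \<pi>U: "\<pi> b \<in> ?U" for b using \<pi>(2) by blast
      obtain D where "a \<in> bdd_polys n D" using ap polys_bdd by blast
      then have UD: "?U \<subseteq> bdd_polys n D" by (intro gspan_bdd) simp
      have "\<exists>P\<in>weyl_inv n K. \<forall>b\<in>?U. P b = ?h (\<pi> b)"
      proof (rule extension_op[OF _ _ UD])
        show "lin (\<lambda>b. ?h (\<pi> b))"
          by (rule linI) (simp_all add: lin_add[OF \<pi>(1)] lin_smul[OF \<pi>(1)] h_add h_smul \<pi>U)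
        show "?h (\<pi> b) \<in> polys n" for b using h(1)[OF \<pi>U] Ms(2) by blast
        show "?h (\<pi> (act g b)) = act g (?h (\<pi> b))" if "g \<in> K" "b \<in> ?U" for g b
          using that orbit(2)[OF ap] \<pi>(3) h_act by (simp add: stable_def)
      qed
      then obtain P where P: "P \<in> weyl_inv n K" "\<And>b. b \<in> ?U \<Longrightarrow> P b = ?h b" using \<pi>(3) by auto
      have fx: "f x \<in> ?U" using f(1) x by (auto simp: bij_betw_def)
      have "P (f x) = x" using P(2)[OF fx] hf[OF x] by simp
      then have "x \<in> gspan K {P a}" using op_orbit[OF P(1) ap fx] by simp
      moreover have "{P a} \<subseteq> ?J" using P(1) by (auto simp: generated_eq[OF a])
      ultimately show "x \<in> gspan K ?J" using gspan_mono[of "{P a}" ?J K] by blast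
    qed
    show "gspan K ?J \<subseteq> rep_component n K (poly_rep ?U)"
      unfolding gspan_def[of _ ?J]
    proof (rule cpoly.span_minimal, clarify)
      fix g b assume g: "g \<in> K" and "b \<in> ?J"
      then obtain P where P: "P \<in> weyl_inv n K" "b = P a" by (auto simp: generated_eq[OF a])
      show "act g b \<in> rep_component n K (poly_rep ?U)"
      proof (cases "b = 0")
        case True
        then show ?thesis by (simp add: lin_0[OF lin_act] rep_component_def cpoly.span_zero)
      next
        case False
        have bp: "b \<in> polys n" using P inv_polys ap by simp
        have "invariant_subspace (mat_group n K) (poly_rep (polys n)) (gspan K {b})"
          using orbit[OF bp] by (simp add: invariant_subspace_iff subspace_gspan)
        moreover have "irreducible_rep (mat_group n K) (poly_rep (gspan K {b}))"
          using orbit_image(1)[OF ap irred_orbit[OF a] P(1)] P(2) False orbit(3)[OF bp] by (simp add: irreducible_iff)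
        moreover have "rep_iso (mat_group n K) (poly_rep (gspan K {b})) (poly_rep ?U)"
          using orbit_image(2)[OF ap irred_orbit[OF a] P(1)] P(2) False by simp
        moreover have "act g b \<in> gspan K {b}" using g by (intro act_in_gspan) auto
        ultimately show ?thesis unfolding rep_component_def by (intro cpoly.span_base) blast
      qed
    qed (simp add: rep_component_def)
  qed
  then show ?thesis
    using J mod_component_eq_gspan[OF J] irred_orbit[OF a] orbit(3)[OF ap]
    by (simp add: corresponds_def irreducible_iff)
qed

end

section \<open>MLS-induction and MLS-restriction\<close>

theorem proposition4p4:
  fixes n r :: nat
    and G H :: "complex mat set"
    and W :: "(complex mat, 'w::ab_group_add) rep"
    and N :: "cpoly set"
  assumes G: "subgroup G (GL n)" "finite G"
    and H: "subgroup H (mat_group n G)"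
    and W: "irreducible_rep (mat_group n H) W"
    and N: "simple_submod n (weyl_inv n H) N"
    and N_W: "corresponds n H N W"
    and ann_simple: "simple_submod n (deg0_part n (weyl_inv n G)) (N_ann n H N)"
    and r: "r = cpoly.dim (N_ann n H N)"
  shows "(\<exists>W1 :: (complex mat, cpoly) rep.
            irreducible_rep (mat_group n G) W1 \<and>
            rep_iso (mat_group n G) (poly_rep (mls_ind n G H W)) (rep_power r W1) \<and>
            corresponds n G (mls_res n G H N) W1) \<and>
         (r = 1 \<longrightarrow> corresponds n G (mls_res n G H N) (poly_rep (mls_ind n G H W)))"
proof -
  have HG: "H \<subseteq> G" using subgroup.subset[OF H] by simp
  have "subgroup H (GL n)"
    using group.incl_subgroup[OF group_GL G(1)] H by (simp add: mat_group_def)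
  then interpret H: finite_linear_group n H
    by (rule finite_linear_group.intro) (rule finite_subset[OF HG G(2)])
  let ?A = "N_ann n H N" and ?d = "H.low_deg N"
  have subN: "submod n (weyl_inv n H) N" "N \<noteq> {0}" "N \<subseteq> polys n"
    using N by (auto simp: simple_submod_def submod_def)
  have A: "?A = N \<inter> hom_polys n ?d" by (rule H.N_ann_eq[OF N])
  have "?A \<subseteq> hom_polys n ?d" using A by simp
  then interpret G: simple_deg0_module n G ?d ?A
    by (intro simple_deg0_module.intro finite_linear_group.intro[OF G] simple_deg0_module_axioms.intro ann_simple)

  have comp: "rep_component n H W = gspan H N"
    using N_W H.mod_component_eq_gspan[OF N] by (simp add: corresponds_def)
  have comp_hom: "rep_component n H W \<inter> hom_polys n e = gspan H (N \<inter> hom_polys n e)" for e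
    unfolding comp by (rule H.gspan_Int_hom[OF subN(1)])
  have "gspan H (N \<inter> hom_polys n e) = {0} \<longleftrightarrow> N \<inter> hom_polys n e = {0}" for e
    using subN cpoly.subspace_0[OF subspace_hom]
    by (intro H.gspan_eq_0_iff) (auto simp: submod_def cpoly.subspace_0)
  \<comment> \<open>The component of \<open>W\<close> and \<open>N\<close> start in the same degree, since translates have the same degree.\<close>
  then have "mls_deg n H W = ?d"
    by (simp add: mls_deg_def comp_hom H.low_deg_def)
  then have "mls_ind n G H W = gspan G (gspan H ?A)"
    by (simp add: mls_ind_def gspan_def[of G] comp_hom A)
  also have "\<dots> = gspan G ?A"
  proof
    have Ap: "?A \<subseteq> polys n" by (rule G.A_polys)
    have "stable H (gspan G ?A)" using G.stable_gspan[OF Ap] HG by (auto simp: stable_def)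
    then have "gspan H ?A \<subseteq> gspan G ?A"
      by (rule gspan_least[OF subspace_gspan _ G.gspan_superset[OF Ap]])
    then show "gspan G (gspan H ?A) \<subseteq> gspan G ?A"
      by (rule gspan_least[OF subspace_gspan G.stable_gspan[OF Ap]])
    show "gspan G ?A \<subseteq> gspan G (gspan H ?A)" by (rule gspan_mono[OF H.gspan_superset[OF Ap]])
  qed
  finally have ind: "mls_ind n G H W = gspan G ?A" .
  have res: "mls_res n G H N = generated (weyl_inv n G) ?A" by (simp add: mls_res_def)

  obtain B where B: "B \<subseteq> ?A" "cpoly.independent B" "?A \<subseteq> cpoly.span B" "card B = r"
    using cpoly.basis_exists[of ?A] r by metis
  have "?A \<noteq> {0}" using ann_simple by (simp add: simple_submod_def)
  moreover have "0 \<in> ?A" by (rule cpoly.subspace_0[OF G.subspace_A])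
  ultimately have "B \<noteq> {}" using B(3) by auto
  then obtain a where aB: "a \<in> B" by blast
  then have a: "a \<in> ?A" "a \<noteq> 0" using B cpoly.dependent_zero by blast+
  \<comment> \<open>Any nonzero vector of the annihilated part would serve; with \<open>a\<close> in the basis, the basis is \<open>{a}\<close> if \<open>r = 1\<close>.\<close>
  let ?W1 = "poly_rep (gspan G {a})"
  have corr: "corresponds n G (mls_res n G H N) ?W1"
    unfolding res by (rule G.generated_corresponds[OF a])
  moreover have "rep_iso (mat_group n G) (poly_rep (mls_ind n G H W)) (rep_power r ?W1)"
    unfolding ind by (rule G.gspan_A_iso[OF B a])
  moreover have "mls_ind n G H W = gspan G {a}" if "r = 1"
  proof -
    have "B = {a}" using that aB B(4) by (metis card_1_singletonE singletonD)
    moreover have "?A = cpoly.span B"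
      using B(1,3) cpoly.span_minimal[OF B(1) G.subspace_A] by blast
    ultimately show ?thesis
      unfolding ind using G.gspan_span[of "{a}"] a G.A_polys by auto
  qed
  ultimately show ?thesis by (auto simp: corresponds_def)
qed

end
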